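(* For $x>0$, let $W_{\alpha(x)}$ be the unilateral weighted shift on $\ell^2(\mathbb{Z}_+)$ with weight sequence given by $\alpha_0:=\sqrt{x}$ and $\alpha_n:=\sqrt{\frac{n+2}{n+3}}$ for $n\ge1$. Then: (i) For every integer $k\ge 1$, $W_{\alpha(x)}$ is $k$-hyponormal if and only if $$0<x\le \frac{2(k+1)^2(k+2)^2}{3k(k+3)(k^2+3k+4)}.$$ (ii) If $0<x\le\frac{667}{990}$, then $W_{\alpha(x)}$ is quartically hyponormal.
   Context: $\ell^2(\mathbb{Z}_+)$ is the complex Hilbert space of square-summable sequences with canonical orthonormal basis $\{e_n\}_{n=0}^\infty$. Given a bounded sequence of positive numbers $\alpha:\alpha_0,\alpha_1,\ldots$ (weights), the (unilateral) weighted shift $W_\alpha$ is the bounded operator on $\ell^2(\mathbb{Z}_+)$ with $W_\alpha e_n=\alpha_ne_{n+1}$ for all $n\ge0$. For bounded operators, $[A,B]:=AB-BA$. A bounded operator $T$ on a complex Hilbert space $\mathcal H$ is $k$-hyponormal if the $k\times k$ operator matrix $([T^{*j},T^i])_{i,j=1}^k$ is positive (semidefinite) on the direct sum of $k$ copies of $\mathcal H$. $T$ is hyponormal if $T^*T\ge TT^*$. $T$ is weakly $k$-hyponormal if $\sum_{j=1}^k\lambda_jT^j$ is hyponormal for all $\lambda_1,\ldots,\lambda_k\in\mathbb{C}$; quartically hyponormal means weakly $4$-hyponormal. *)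

theory Defs
  imports "HOL-Analysis.Analysis"
begin

section \<open>The complex Hilbert space of square-summable sequences\<close>

lemma square_summable_add:
  fixes f g :: "nat \<Rightarrow> complex"
  assumes "summable (\<lambda>n. (cmod (f n))\<^sup>2)" "summable (\<lambda>n. (cmod (g n))\<^sup>2)"
  shows "summable (\<lambda>n. (cmod (f n + g n))\<^sup>2)"
proof (rule summable_comparison_test')
  show "summable (\<lambda>n. 2 * (cmod (f n))\<^sup>2 + 2 * (cmod (g n))\<^sup>2)"
    using assms by (intro summable_add summable_mult)
  fix n
  have "(cmod (f n + g n))\<^sup>2 \<le> (cmod (f n) + cmod (g n))\<^sup>2"
    by (intro power_mono norm_triangle_ineq) auto
  also have "\<dots> \<le> 2 * (cmod (f n))\<^sup>2 + 2 * (cmod (g n))\<^sup>2"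
    using sum_squares_bound[of "cmod (f n)" "cmod (g n)"]
    by (simp add: power2_sum)
  finally show "norm ((cmod (f n + g n))\<^sup>2) \<le> 2 * (cmod (f n))\<^sup>2 + 2 * (cmod (g n))\<^sup>2"
    by simp
qed

lemma square_summable_mult:
  fixes f g :: "nat \<Rightarrow> complex"
  assumes "summable (\<lambda>n. (cmod (f n))\<^sup>2)" "\<And>n. cmod (g n) \<le> B"
  shows "summable (\<lambda>n. (cmod (g n * f n))\<^sup>2)"
proof (rule summable_comparison_test')
  show "summable (\<lambda>n. B\<^sup>2 * (cmod (f n))\<^sup>2)"
    using assms(1) by (rule summable_mult)
  show "norm ((cmod (g n * f n))\<^sup>2) \<le> B\<^sup>2 * (cmod (f n))\<^sup>2" for n
    using assms(2)[of n] by (simp add: norm_mult power_mult_distrib mult_right_mono power_mono)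
qed

typedef ell2 = "{f :: nat \<Rightarrow> complex. summable (\<lambda>n. (cmod (f n))\<^sup>2)}"
  morphisms ell2_nth Abs_ell2
  by (rule exI[of _ "\<lambda>_. 0"]) simp

setup_lifting type_definition_ell2

lemma ell2_summable: "summable (\<lambda>n. (cmod (ell2_nth x n))\<^sup>2)"
  using ell2_nth[of x] by simp

lemma ell2_eqI: "(\<And>n. ell2_nth x n = ell2_nth y n) \<Longrightarrow> x = y"
  by (simp add: ell2_nth_inject[symmetric] fun_eq_iff)

lift_definition scaleC :: "complex \<Rightarrow> ell2 \<Rightarrow> ell2"  (infixr \<open>*\<^sub>C\<close> 75)
  is "\<lambda>c f n. c * f n"
  by (rule square_summable_mult) auto

text \<open>The inner product is linear in the first and conjugate-linear in the second argument.\<close>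

definition cinner :: "ell2 \<Rightarrow> ell2 \<Rightarrow> complex"
  where "cinner x y = (\<Sum>n. ell2_nth x n * cnj (ell2_nth y n))"

lemma cinner_summable_norm: "summable (\<lambda>n. cmod (ell2_nth x n * cnj (ell2_nth y n)))"
proof (rule summable_comparison_test')
  show "summable (\<lambda>n. (cmod (ell2_nth x n))\<^sup>2 + (cmod (ell2_nth y n))\<^sup>2)"
    by (intro summable_add ell2_summable)
  fix n
  have "2 * (cmod (ell2_nth x n) * cmod (ell2_nth y n))
      \<le> (cmod (ell2_nth x n))\<^sup>2 + (cmod (ell2_nth y n))\<^sup>2"
    using sum_squares_bound[of "cmod (ell2_nth x n)" "cmod (ell2_nth y n)"] by simp
  moreover have "0 \<le> cmod (ell2_nth x n) * cmod (ell2_nth y n)"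
    by simp
  ultimately show "norm (cmod (ell2_nth x n * cnj (ell2_nth y n)))
      \<le> (cmod (ell2_nth x n))\<^sup>2 + (cmod (ell2_nth y n))\<^sup>2"
    unfolding real_norm_def abs_norm_cancel norm_mult complex_mod_cnj by linarith
qed

lemma cinner_summable: "summable (\<lambda>n. ell2_nth x n * cnj (ell2_nth y n))"
  using cinner_summable_norm by (rule summable_norm_cancel)

instantiation ell2 :: real_vector
begin

lift_definition zero_ell2 :: ell2 is "\<lambda>_. 0"
  by simp

lift_definition plus_ell2 :: "ell2 \<Rightarrow> ell2 \<Rightarrow> ell2" is "\<lambda>f g n. f n + g n"
  by (rule square_summable_add)

lift_definition uminus_ell2 :: "ell2 \<Rightarrow> ell2" is "\<lambda>f n. - f n"
  by simp

definition minus_ell2 :: "ell2 \<Rightarrow> ell2 \<Rightarrow> ell2"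
  where "minus_ell2 x y = x + - y"

definition scaleR_ell2 :: "real \<Rightarrow> ell2 \<Rightarrow> ell2"
  where "scaleR_ell2 r x = complex_of_real r *\<^sub>C x"

instance
  by standard
    (auto intro!: ell2_eqI simp: minus_ell2_def scaleR_ell2_def plus_ell2.rep_eq
      zero_ell2.rep_eq uminus_ell2.rep_eq scaleC.rep_eq algebra_simps)

end

lemma ell2_nth_minus: "ell2_nth (x - y) n = ell2_nth x n - ell2_nth y n"
  unfolding minus_ell2_def plus_ell2.rep_eq uminus_ell2.rep_eq by simp

lemma ell2_nth_scaleR: "ell2_nth (r *\<^sub>R x) n = complex_of_real r * ell2_nth x n"
  by (simp add: scaleR_ell2_def scaleC.rep_eq)

lemmas ell2_nth_simps = zero_ell2.rep_eq plus_ell2.rep_eq uminus_ell2.rep_eq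
  ell2_nth_minus scaleC.rep_eq ell2_nth_scaleR

lemma cinner_add_left: "cinner (x + y) z = cinner x z + cinner y z"
  unfolding cinner_def
  by (simp add: suminf_add cinner_summable ell2_nth_simps distrib_right)

lemma cinner_scaleC_left: "cinner (c *\<^sub>C x) y = c * cinner x y"
  unfolding cinner_def
  by (simp add: suminf_mult[symmetric] cinner_summable ell2_nth_simps mult.assoc)

lemma cinner_commute: "cinner x y = cnj (cinner y x)"
proof -
  have "(\<lambda>n. cnj (ell2_nth y n * cnj (ell2_nth x n))) sums cnj (cinner y x)"
    unfolding cinner_def sums_cnj by (rule summable_sums[OF cinner_summable])
  then show ?thesis
    unfolding cinner_def by (simp add: sums_iff mult.commute)
qed

lemma cinner_self: "cinner x x = complex_of_real (\<Sum>n. (cmod (ell2_nth x n))\<^sup>2)"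
proof -
  have "(\<lambda>n. complex_of_real ((cmod (ell2_nth x n))\<^sup>2))
      sums complex_of_real (\<Sum>n. (cmod (ell2_nth x n))\<^sup>2)"
    by (intro sums_of_real summable_sums ell2_summable)
  then show ?thesis
    unfolding cinner_def complex_norm_square by (simp only: sums_iff)
qed

text \<open>The norm, and hence the library notion of a bounded linear map, comes from the
  real inner product \<open>Re \<langle>x, y\<rangle>\<close>, which induces the same norm as \<open>\<langle>x, y\<rangle>\<close>.\<close>

instantiation ell2 :: real_inner
begin

definition inner_ell2 :: "ell2 \<Rightarrow> ell2 \<Rightarrow> real"
  where "inner_ell2 x y = Re (cinner x y)"

definition norm_ell2 :: "ell2 \<Rightarrow> real"
  where "norm_ell2 x = sqrt (inner x x)"

definition dist_ell2 :: "ell2 \<Rightarrow> ell2 \<Rightarrow> real"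
  where "dist_ell2 x y = norm (x - y)"

definition sgn_ell2 :: "ell2 \<Rightarrow> ell2"
  where "sgn_ell2 x = x /\<^sub>R norm x"

definition uniformity_ell2 :: "(ell2 \<times> ell2) filter"
  where "uniformity_ell2 = (INF e\<in>{0<..}. principal {(x, y). dist x y < e})"

definition open_ell2 :: "ell2 set \<Rightarrow> bool"
  where "open_ell2 S \<longleftrightarrow> (\<forall>x\<in>S. \<forall>\<^sub>F (x', y) in uniformity. x' = x \<longrightarrow> y \<in> S)"

instance
proof
  fix x y z :: ell2 and r :: real
  show "inner x y = inner y x"
    unfolding inner_ell2_def by (subst cinner_commute) simp
  show "inner (x + y) z = inner x z + inner y z"
    by (simp add: inner_ell2_def cinner_add_left)
  show "inner (r *\<^sub>R x) y = r * inner x y"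
    by (simp add: inner_ell2_def scaleR_ell2_def cinner_scaleC_left)
  show "0 \<le> inner x x"
    by (simp add: inner_ell2_def cinner_self suminf_nonneg ell2_summable)
  show "inner x x = 0 \<longleftrightarrow> x = 0"
    by (auto simp: inner_ell2_def cinner_self suminf_eq_zero_iff ell2_summable zero_ell2.rep_eq
        intro: ell2_eqI)
qed (rule dist_ell2_def sgn_ell2_def uniformity_ell2_def open_ell2_def norm_ell2_def)+

end

lemma norm_ell2: "norm x = sqrt (\<Sum>n. (cmod (ell2_nth x n))\<^sup>2)" for x :: ell2
  by (simp add: norm_ell2_def inner_ell2_def cinner_self)

lift_definition ell2_basis :: "nat \<Rightarrow> ell2" is "\<lambda>k n. if n = k then 1 else 0"
  by (rule summable_finite[of "{k}" for k]) auto


section \<open>Bounded operators\<close>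

definition bounded_clinear :: "(ell2 \<Rightarrow> ell2) \<Rightarrow> bool"
  where "bounded_clinear T \<longleftrightarrow> bounded_linear T \<and> (\<forall>c x. T (c *\<^sub>C x) = c *\<^sub>C T x)"

text \<open>The adjoint is only meant to be used for bounded operators, where it exists and is
  unique (lemmas \<open>cinner_cadjoint\<close> and \<open>cadjoint_eqI\<close>).\<close>

definition cadjoint :: "(ell2 \<Rightarrow> ell2) \<Rightarrow> ell2 \<Rightarrow> ell2"
  where "cadjoint T = (SOME S. \<forall>x y. cinner (T x) y = cinner x (S y))"

lemma cinner_diff_left: "cinner (x - y) z = cinner x z - cinner y z"
  using cinner_add_left[of "x - y" y z] by simp

lemma cinner_diff_right: "cinner x (y - z) = cinner x y - cinner x z"
  by (subst (1 2 3) cinner_commute) (simp add: cinner_diff_left)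

lemma cinner_zero_left: "cinner 0 y = 0"
  using cinner_diff_left[of 0 0 y] by simp

lemma cinner_sum_left: "cinner (\<Sum>i\<in>A. f i) y = (\<Sum>i\<in>A. cinner (f i) y)"
  by (induction A rule: infinite_finite_induct) (auto simp: cinner_zero_left cinner_add_left)

lemma cadjoint_eqI:
  assumes "\<And>x y. cinner (T x) y = cinner x (S y)"
  shows "cadjoint T = S"
proof -
  have *: "\<forall>x y. cinner (T x) y = cinner x (cadjoint T y)"
    unfolding cadjoint_def by (rule someI[of _ S]) (use assms in blast)
  have "cadjoint T y - S y = 0" for y
  proof -
    have "cinner z (cadjoint T y) = cinner z (S y)" for z
      using *[rule_format, of z y] assms[of z y] by simp
    then have "cinner z (cadjoint T y - S y) = 0" for z
      by (simp add: cinner_diff_right)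
    then have "inner (cadjoint T y - S y) (cadjoint T y - S y) = 0"
      by (simp add: inner_ell2_def)
    then show ?thesis
      by (simp only: inner_eq_zero_iff)
  qed
  then show ?thesis
    by (simp add: fun_eq_iff)
qed

lemma norm_scaleC: "norm (c *\<^sub>C x) = cmod c * norm x"
  by (simp add: norm_ell2 scaleC.rep_eq norm_mult power_mult_distrib suminf_mult ell2_summable
      real_sqrt_mult)

lemma cmod_cinner_le: "cmod (cinner x y) \<le> norm x * norm y"
proof (cases "cinner x y = 0")
  case False
  define u where "u = cnj (cinner x y) / cmod (cinner x y)"
  have u: "cmod u = 1"
    using False by (simp add: u_def norm_divide)
  have "u * cinner x y = cmod (cinner x y)"
    using False complex_norm_square[of "cinner x y"]
    by (simp add: u_def field_simps power2_eq_square)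
  then have "cmod (cinner x y) = inner (u *\<^sub>C x) y"
    by (simp add: inner_ell2_def cinner_scaleC_left)
  also have "\<dots> \<le> norm (u *\<^sub>C x) * norm y"
    by (rule norm_cauchy_schwarz)
  finally show ?thesis
    by (simp add: norm_scaleC u)
qed simp

lemma ell2_nth_sum: "ell2_nth (\<Sum>i\<in>A. f i) n = (\<Sum>i\<in>A. ell2_nth (f i) n)"
  by (induction A rule: infinite_finite_induct) (auto simp: ell2_nth_simps)

lemma ell2_nth_sum_basis:
  "ell2_nth (\<Sum>i<N. f i *\<^sub>C ell2_basis i) n = (if n < N then f n else 0)"
proof -
  have "ell2_nth (\<Sum>i<N. f i *\<^sub>C ell2_basis i) n = (\<Sum>i<N. if n = i then f i else 0)"
    unfolding ell2_nth_sum by (intro sum.cong) (auto simp: scaleC.rep_eq ell2_basis.rep_eq)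
  then show ?thesis
    by simp
qed

lemma norm_sum_basis: "norm (\<Sum>i<N. f i *\<^sub>C ell2_basis i) = sqrt (\<Sum>i<N. (cmod (f i))\<^sup>2)"
proof -
  have "(\<Sum>n. (cmod (ell2_nth (\<Sum>i<N. f i *\<^sub>C ell2_basis i) n))\<^sup>2)
      = (\<Sum>n<N. (cmod (ell2_nth (\<Sum>i<N. f i *\<^sub>C ell2_basis i) n))\<^sup>2)"
    by (rule suminf_finite) (auto simp: ell2_nth_sum_basis)
  then show ?thesis
    by (simp add: norm_ell2 ell2_nth_sum_basis)
qed

lemma ell2_basis_expansion: "(\<lambda>N. \<Sum>i<N. ell2_nth x i *\<^sub>C ell2_basis i) \<longlonglongrightarrow> x"
proof -
  let ?g = "\<lambda>n. (cmod (ell2_nth x n))\<^sup>2"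
  let ?s = "\<lambda>N. \<Sum>i<N. ell2_nth x i *\<^sub>C ell2_basis i"
  have "norm (?s N - x) = sqrt (suminf ?g - sum ?g {..<N})" for N
  proof -
    have "(\<lambda>n. if n < N then ?g n else 0) sums sum ?g {..<N}"
      using sums_If_finite[of "\<lambda>n. n < N" ?g] by (simp add: lessThan_def)
    from sums_diff[OF summable_sums[OF ell2_summable[of x]] this]
    have "(\<lambda>n. (cmod (ell2_nth (?s N - x) n))\<^sup>2) sums (suminf ?g - sum ?g {..<N})"
      by (rule sums_cong[THEN iffD1, rotated])
        (auto simp: ell2_nth_sum_basis ell2_nth_minus)
    then show ?thesis
      by (simp add: norm_ell2 sums_iff)
  qed
  moreover have "(\<lambda>N. sqrt (suminf ?g - sum ?g {..<N})) \<longlonglongrightarrow> sqrt (suminf ?g - suminf ?g)"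
    by (intro tendsto_intros summable_LIMSEQ ell2_summable)
  ultimately have "(\<lambda>N. norm (?s N - x)) \<longlonglongrightarrow> 0"
    by simp
  then show ?thesis
    by (rule LIM_zero_cancel[OF tendsto_norm_zero_cancel])
qed

lemma cinner_cadjoint:
  assumes "bounded_clinear T"
  shows "cinner (T x) y = cinner x (cadjoint T y)"
proof -
  have T: "bounded_linear T" and T_scaleC: "T (c *\<^sub>C z) = c *\<^sub>C T z" for c z
    using assms unfolding bounded_clinear_def by blast+
  obtain K where K: "0 \<le> K" "\<And>z. norm (T z) \<le> norm z * K"
    using bounded_linear.nonneg_bounded[OF T] by blast
  define f where "f y n = cinner y (T (ell2_basis n))" for y n
  have T_sum: "cinner (T (\<Sum>i<N. c i *\<^sub>C ell2_basis i)) y = (\<Sum>i<N. c i * cnj (f y i))" for N c y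
    by (simp add: f_def linear_sum[OF bounded_linear.linear[OF T]] T_scaleC cinner_sum_left
        cinner_scaleC_left cinner_commute[of _ y, symmetric])
  have cancel: "a \<le> b" if "a * a \<le> b * a" "0 \<le> a" "0 \<le> b" for a b :: real
    using that by (cases "a = 0") auto
  have bound: "(\<Sum>n<N. (cmod (f y n))\<^sup>2) \<le> (norm y * K)\<^sup>2" for N y
  proof -
    let ?s = "\<Sum>n<N. (cmod (f y n))\<^sup>2"
    let ?v = "\<Sum>n<N. f y n *\<^sub>C ell2_basis n"
    have s0: "0 \<le> ?s"
      by (intro sum_nonneg) auto
    have "cinner (T ?v) y = complex_of_real ?s"
      by (subst T_sum, subst of_real_sum) (intro sum.cong refl complex_norm_square[symmetric])
    then have "cmod (cinner (T ?v) y) = \<bar>?s\<bar>"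
      by (metis norm_of_real)
    then have "?s = cmod (cinner (T ?v) y)"
      using s0 by linarith
    also have "\<dots> \<le> norm (T ?v) * norm y"
      by (rule cmod_cinner_le)
    also have "\<dots> \<le> norm ?v * K * norm y"
      by (intro mult_right_mono K) auto
    finally have "sqrt ?s * sqrt ?s \<le> (norm y * K) * sqrt ?s"
      using s0 by (simp add: norm_sum_basis mult_ac)
    then have "sqrt ?s \<le> norm y * K"
      by (rule cancel) (simp_all add: s0 K(1))
    then show ?thesis
      by (rule sqrt_le_D)
  qed
  have summ: "summable (\<lambda>n. (cmod (f y n))\<^sup>2)" for y
    using bound by (intro summableI_nonneg_bounded) auto
  define S where "S y = Abs_ell2 (f y)" for y
  have S: "ell2_nth (S y) = f y" for y
    unfolding S_def using summ by (intro Abs_ell2_inverse) simp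
  have adj: "cinner (T x) y = cinner x (S y)" for x y
  proof (rule LIMSEQ_unique)
    let ?s = "\<lambda>N. \<Sum>i<N. ell2_nth x i *\<^sub>C ell2_basis i"
    show "(\<lambda>N. cinner (T (?s N)) y) \<longlonglongrightarrow> cinner x (S y)"
      unfolding T_sum using summable_LIMSEQ[OF cinner_summable[of x "S y"]]
      by (simp add: cinner_def S)
    have "(\<lambda>N. norm (T (?s N) - T x) * norm y) \<longlonglongrightarrow> norm (T x - T x) * norm y"
      by (intro tendsto_intros bounded_linear.tendsto[OF T] ell2_basis_expansion)
    then have "(\<lambda>N. norm (T (?s N) - T x) * norm y) \<longlonglongrightarrow> 0"
      by (simp only: diff_self norm_zero mult_zero_left)
    then have "(\<lambda>N. cinner (T (?s N) - T x) y) \<longlonglongrightarrow> 0"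
      by (rule Lim_null_comparison[OF always_eventually, rotated]) (intro allI cmod_cinner_le)
    then show "(\<lambda>N. cinner (T (?s N)) y) \<longlonglongrightarrow> cinner (T x) y"
      unfolding cinner_diff_left by (rule LIM_zero_cancel)
  qed
  from cadjoint_eqI[of T S, OF adj] show ?thesis
    by (simp add: adj)
qed

definition commutator :: "(ell2 \<Rightarrow> ell2) \<Rightarrow> (ell2 \<Rightarrow> ell2) \<Rightarrow> ell2 \<Rightarrow> ell2"
  where "commutator A B x = A (B x) - B (A x)"

definition positive_op :: "(ell2 \<Rightarrow> ell2) \<Rightarrow> bool"
  where "positive_op A \<longleftrightarrow> (\<forall>x. cinner (A x) x \<in> \<real>\<^sub>\<ge>\<^sub>0)"

text \<open>Positivity of a matrix of operators on the direct sum of \<open>k\<close> copies of the space: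
  a vector of the direct sum is given by the values \<open>x 1, \<dots>, x k\<close>, the \<open>i\<close>-th component of
  \<open>M x\<close> is \<open>\<Sum>j. M i j (x j)\<close>, and the inner product is the sum of those of the components.\<close>

definition positive_op_matrix :: "nat \<Rightarrow> (nat \<Rightarrow> nat \<Rightarrow> ell2 \<Rightarrow> ell2) \<Rightarrow> bool"
  where "positive_op_matrix k M \<longleftrightarrow>
    (\<forall>x :: nat \<Rightarrow> ell2. (\<Sum>i=1..k. cinner (\<Sum>j=1..k. M i j (x j)) (x i)) \<in> \<real>\<^sub>\<ge>\<^sub>0)"

definition k_hyponormal :: "nat \<Rightarrow> (ell2 \<Rightarrow> ell2) \<Rightarrow> bool"
  where "k_hyponormal k T \<longleftrightarrow> bounded_clinear T \<and>
    positive_op_matrix k (\<lambda>i j. commutator (cadjoint T ^^ j) (T ^^ i))"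

definition hyponormal :: "(ell2 \<Rightarrow> ell2) \<Rightarrow> bool"
  where "hyponormal T \<longleftrightarrow> bounded_clinear T \<and>
    positive_op (\<lambda>x. cadjoint T (T x) - T (cadjoint T x))"

definition weakly_k_hyponormal :: "nat \<Rightarrow> (ell2 \<Rightarrow> ell2) \<Rightarrow> bool"
  where "weakly_k_hyponormal k T \<longleftrightarrow> bounded_clinear T \<and>
    (\<forall>c :: nat \<Rightarrow> complex. hyponormal (\<lambda>x. \<Sum>j=1..k. c j *\<^sub>C (T ^^ j) x))"

abbreviation quartically_hyponormal :: "(ell2 \<Rightarrow> ell2) \<Rightarrow> bool"
  where "quartically_hyponormal \<equiv> weakly_k_hyponormal 4"


section \<open>Weighted shifts\<close>

text \<open>The sequence on the right-hand side is square-summable for bounded weights; the lemmas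
  below show that the result is then a bounded operator mapping \<open>e\<^sub>n\<close> to \<open>\<alpha>\<^sub>n e\<^sub>n\<^sub>+\<^sub>1\<close>.\<close>

definition weighted_shift :: "(nat \<Rightarrow> real) \<Rightarrow> ell2 \<Rightarrow> ell2"
  where "weighted_shift \<alpha> x =
    Abs_ell2 (\<lambda>n. case n of 0 \<Rightarrow> 0 | Suc m \<Rightarrow> complex_of_real (\<alpha> m) * ell2_nth x m)"

lemma ell2_nth_weighted_shift:
  assumes "bounded (range \<alpha>)"
  shows "ell2_nth (weighted_shift \<alpha> x) n =
    (case n of 0 \<Rightarrow> 0 | Suc m \<Rightarrow> complex_of_real (\<alpha> m) * ell2_nth x m)"
proof -
  obtain B where B: "\<And>n. \<bar>\<alpha> n\<bar> \<le> B"
    using assms by (auto simp: bounded_iff)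
  have "summable (\<lambda>n. (cmod (case Suc n of 0 \<Rightarrow> 0
      | Suc m \<Rightarrow> complex_of_real (\<alpha> m) * ell2_nth x m))\<^sup>2)"
    using square_summable_mult[OF ell2_summable, of "\<lambda>n. complex_of_real (\<alpha> n)" B x] B by simp
  then have "summable (\<lambda>n. (cmod (case n of 0 \<Rightarrow> 0
      | Suc m \<Rightarrow> complex_of_real (\<alpha> m) * ell2_nth x m))\<^sup>2)"
    by (rule summable_Suc_iff[THEN iffD1])
  then show ?thesis
    unfolding weighted_shift_def by (subst Abs_ell2_inverse) auto
qed

lemma weighted_shift_basis:
  assumes "bounded (range \<alpha>)"
  shows "weighted_shift \<alpha> (ell2_basis n) = complex_of_real (\<alpha> n) *\<^sub>C ell2_basis (Suc n)"
  by (rule ell2_eqI)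
    (auto simp: ell2_nth_weighted_shift[OF assms] ell2_basis.rep_eq scaleC.rep_eq split: nat.split)

lemma bounded_clinear_weighted_shift:
  assumes "bounded (range \<alpha>)"
  shows "bounded_clinear (weighted_shift \<alpha>)"
proof -
  note nth = ell2_nth_weighted_shift[OF assms]
  obtain B where B: "\<And>n. \<bar>\<alpha> n\<bar> \<le> B"
    using assms by (auto simp: bounded_iff)
  have B0: "0 \<le> B"
    using B[of 0] by simp
  have norm: "norm (weighted_shift \<alpha> x) \<le> norm x * B" for x
  proof -
    let ?w = "\<lambda>n. (cmod (ell2_nth (weighted_shift \<alpha> x) n))\<^sup>2"
    have "suminf ?w = (\<Sum>n. ?w (Suc n))"
      using suminf_split_head[OF ell2_summable[of "weighted_shift \<alpha> x"]] by (simp add: nth)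
    also have "\<dots> \<le> (\<Sum>n. B\<^sup>2 * (cmod (ell2_nth x n))\<^sup>2)"
    proof (rule suminf_le)
      show "?w (Suc n) \<le> B\<^sup>2 * (cmod (ell2_nth x n))\<^sup>2" for n
        using power_mono[OF B[of n], of 2]
        by (simp add: nth norm_mult power_mult_distrib mult_right_mono)
      show "summable (\<lambda>n. ?w (Suc n))"
        using ell2_summable[of "weighted_shift \<alpha> x"] summable_Suc_iff[of ?w] by blast
    qed (intro summable_mult ell2_summable)
    also have "\<dots> = B\<^sup>2 * (\<Sum>n. (cmod (ell2_nth x n))\<^sup>2)"
      by (intro suminf_mult ell2_summable)
    finally have "sqrt (suminf ?w) \<le> sqrt (B\<^sup>2 * (\<Sum>n. (cmod (ell2_nth x n))\<^sup>2))"
      by (rule real_sqrt_le_mono)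
    then show ?thesis
      using B0 by (simp add: norm_ell2 real_sqrt_mult mult.commute)
  qed
  have "bounded_linear (weighted_shift \<alpha>)"
    by (rule bounded_linear_intro[OF _ _ norm])
      (auto intro!: ell2_eqI simp: nth ell2_nth_simps algebra_simps split: nat.split)
  moreover have "weighted_shift \<alpha> (c *\<^sub>C x) = c *\<^sub>C weighted_shift \<alpha> x" for c x
    by (rule ell2_eqI) (auto simp: nth ell2_nth_simps split: nat.split)
  ultimately show ?thesis
    by (simp add: bounded_clinear_def)
qed

definition alpha_weights :: "real \<Rightarrow> nat \<Rightarrow> real"
  where "alpha_weights x n = (if n = 0 then sqrt x else sqrt ((real n + 2) / (real n + 3)))"

lemma bounded_alpha_weights: "bounded (range (alpha_weights x))"
proof (rule boundedI)
  show "norm y \<le> \<bar>sqrt x\<bar> + 1" if "y \<in> range (alpha_weights x)" for y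
  proof -
    have "sqrt ((real n + 2) / (real n + 3)) \<le> 1" for n
      by simp
    then show ?thesis
      using that by (auto simp: alpha_weights_def intro: add_increasing)
  qed
qed

end

theory Submission
  imports Defs "HOL-Computational_Algebra.Polynomial"
begin

text \<open>With moments \<open>\<gamma>\<^sub>0 = 1\<close> and \<open>\<gamma>\<^sub>n = 3x / (n + 2)\<close>, the quadratic form of the operator matrix
  \<open>([T\<^sup>*\<^sup>j, T\<^sup>i])\<close> splits along diagonals into the forms of the \<open>k \<times> k\<close> matrices \<open>\<gamma>\<^sub>n\<^sub>+\<^sub>i\<^sub>+\<^sub>j\<close> (\<open>n < 0\<close>) and
  \<open>\<gamma>\<^sub>n\<^sub>+\<^sub>i\<^sub>+\<^sub>j - \<gamma>\<^sub>n\<^sub>+\<^sub>i \<gamma>\<^sub>n\<^sub>+\<^sub>j / \<gamma>\<^sub>n\<close> (\<open>n \<ge> 0\<close>). For \<open>n \<noteq> 0\<close> they are \<open>3x\<close>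
  times diagonal congruences of Hankel matrices of measures on \<open>[0, 1]\<close>, hence positive. The form for \<open>n = 0\<close>
  is the only one where \<open>x\<close> is more than a factor, and inverting the matrix \<open>1 / (i + j + 2)\<close> explicitly gives the exact range of \<open>x\<close> where it is positive.

  For quartic hyponormality only the values of the form at \<open>X\<^sub>j = c\<^sub>j\<^sup>* y\<close> matter. For \<open>x \<le> 667/990\<close> the form
  for \<open>n = 0\<close> is bounded below by a multiple of \<open>Re (c\<^sub>1\<^sup>* y\<^sub>1 c\<^sub>2 y\<^sub>2\<^sup>*)\<close>, and this is absorbed, by AM-GM, by the
  positive multiples of \<open>|c\<^sub>1 y\<^sub>2|\<^sup>2\<close> and \<open>|c\<^sub>2 y\<^sub>1|\<^sup>2\<close> contained in the forms for \<open>n = 1\<close> and \<open>n = -1\<close>.\<close>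

section \<open>Hermitian forms with real coefficients\<close>

text \<open>By symmetry of \<open>M\<close> the mixed products of real and imaginary parts cancel.
  Positivity of a complex form thus reduces to one real quadratic form, evaluated at the real and at
  the imaginary parts.\<close>

lemma hermitian_form_eq:
  fixes M :: "nat \<Rightarrow> nat \<Rightarrow> real" and v :: "nat \<Rightarrow> complex"
  assumes sym: "\<And>i j. i \<in> I \<Longrightarrow> j \<in> I \<Longrightarrow> M i j = M j i"
  shows "(\<Sum>i\<in>I. \<Sum>j\<in>I. complex_of_real (M i j) * v j * cnj (v i)) =
    complex_of_real ((\<Sum>i\<in>I. \<Sum>j\<in>I. M i j * Re (v i) * Re (v j))
      + (\<Sum>i\<in>I. \<Sum>j\<in>I. M i j * Im (v i) * Im (v j)))"
    (is "?L = _")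
proof (rule complex_eqI)
  show "Re ?L = Re (complex_of_real ((\<Sum>i\<in>I. \<Sum>j\<in>I. M i j * Re (v i) * Re (v j))
      + (\<Sum>i\<in>I. \<Sum>j\<in>I. M i j * Im (v i) * Im (v j))))"
    by (simp add: sum.distrib[symmetric] algebra_simps)
  have "(\<Sum>i\<in>I. \<Sum>j\<in>I. M i j * Im (v j) * Re (v i)) = (\<Sum>i\<in>I. \<Sum>j\<in>I. M i j * Re (v j) * Im (v i))"
    by (subst sum.swap) (intro sum.cong refl, simp add: sym)
  then show "Im ?L = Im (complex_of_real ((\<Sum>i\<in>I. \<Sum>j\<in>I. M i j * Re (v i) * Re (v j))
      + (\<Sum>i\<in>I. \<Sum>j\<in>I. M i j * Im (v i) * Im (v j))))"
    by (simp add: sum_subtractf algebra_simps)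
qed

section \<open>Commutators of powers of a weighted shift\<close>

definition weight_prod :: "(nat \<Rightarrow> real) \<Rightarrow> nat \<Rightarrow> real"
  where "weight_prod \<alpha> n = (\<Prod>i<n. \<alpha> i)"

definition moment :: "(nat \<Rightarrow> real) \<Rightarrow> nat \<Rightarrow> real"
  where "moment \<alpha> n = (weight_prod \<alpha> n)\<^sup>2"

text \<open>The index \<open>p\<close> stands for the diagonal \<open>n = p - k\<close>, which ranges over the integers
  \<open>\<ge> -k\<close>: only \<open>X i\<close> at the coordinate \<open>n + i\<close> is coupled to \<open>X j\<close> at the coordinate \<open>n + j\<close>.\<close>

definition shift_kernel :: "(nat \<Rightarrow> real) \<Rightarrow> nat \<Rightarrow> nat \<Rightarrow> nat \<Rightarrow> nat \<Rightarrow> real"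
  where "shift_kernel \<alpha> k p i j =
    (if k \<le> p + i \<and> k \<le> p + j then moment \<alpha> (p + i + j - k) else 0)
    - (if k \<le> p then moment \<alpha> (p - k + i) * moment \<alpha> (p - k + j) / moment \<alpha> (p - k) else 0)"

text \<open>Coordinates with respect to the orthogonal vectors \<open>T^m e_0 = w_m e_m\<close>,
  which \<open>T\<close> shifts without weights and whose squared norms are the moments. The value 0
  stands for the missing negative coordinates.\<close>

definition diagonal_coeff :: "(nat \<Rightarrow> real) \<Rightarrow> nat \<Rightarrow> (nat \<Rightarrow> ell2) \<Rightarrow> nat \<Rightarrow> nat \<Rightarrow> complex"
  where "diagonal_coeff \<alpha> k X p i =
    (if k \<le> p + i then ell2_nth (X i) (p + i - k) / weight_prod \<alpha> (p + i - k) else 0)"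

definition diagonal_form :: "(nat \<Rightarrow> real) \<Rightarrow> nat \<Rightarrow> (nat \<Rightarrow> ell2) \<Rightarrow> nat \<Rightarrow> real"
  where "diagonal_form \<alpha> k X p =
    (\<Sum>i=1..k. \<Sum>j=1..k. shift_kernel \<alpha> k p i j
      * Re (diagonal_coeff \<alpha> k X p i) * Re (diagonal_coeff \<alpha> k X p j))
    + (\<Sum>i=1..k. \<Sum>j=1..k. shift_kernel \<alpha> k p i j
      * Im (diagonal_coeff \<alpha> k X p i) * Im (diagonal_coeff \<alpha> k X p j))"

lemma shift_kernel_commute: "shift_kernel \<alpha> k p i j = shift_kernel \<alpha> k p j i"
  by (simp add: shift_kernel_def add_ac mult.commute)

section \<open>Inner products and series in coordinates\<close>

lemma cinner_eq_sums: "(\<lambda>n. ell2_nth x n * cnj (ell2_nth y n)) sums cinner x y"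
  unfolding cinner_def by (rule summable_sums[OF cinner_summable])

lemma cinner_basis_left: "cinner (ell2_basis n) y = cnj (ell2_nth y n)"
proof -
  have "(\<lambda>m. ell2_nth (ell2_basis n) m * cnj (ell2_nth y m)) sums cnj (ell2_nth y n)"
    using sums_single[of n "\<lambda>m. cnj (ell2_nth y m)"]
    by (rule sums_cong[THEN iffD1, rotated]) (simp add: ell2_basis.rep_eq)
  then show ?thesis
    using cinner_eq_sums sums_unique2 by blast
qed

lemma cinner_basis_right: "cinner x (ell2_basis n) = ell2_nth x n"
  by (subst cinner_commute) (simp add: cinner_basis_left)

text \<open>Drops \<open>a\<close> leading zeros and prepends \<open>b\<close> others, which aligns
  the series of all pairs \<open>(i, j)\<close> along the common index \<open>p\<close>.\<close>

lemma sums_reindex: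
  fixes f :: "nat \<Rightarrow> 'a :: real_normed_vector"
  assumes "f sums s" "\<And>m. m < a \<Longrightarrow> f m = 0"
  shows "(\<lambda>p. if b \<le> p then f (p - b + a) else 0) sums s"
proof -
  have "(\<lambda>m. f (m + a)) sums s"
    using sums_zero_iff_shift[of a f s] assms by simp
  then show ?thesis
    using sums_zero_iff_shift[of b "\<lambda>p. if b \<le> p then f (p - b + a) else 0" s] by simp
qed

section \<open>Linear combinations of powers of an operator and their adjoints\<close>

lemma bounded_clinear_compose:
  assumes "bounded_clinear S" "bounded_clinear T"
  shows "bounded_clinear (\<lambda>x. S (T x))"
  using assms by (auto simp: bounded_clinear_def intro: bounded_linear_compose)

lemma bounded_clinear_funpow: "bounded_clinear T \<Longrightarrow> bounded_clinear (T ^^ n)"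
proof (induction n)
  case 0
  then show ?case by (simp add: bounded_clinear_def bounded_linear_ident id_def)
next
  case (Suc n)
  then show ?case
    using bounded_clinear_compose[of T "T ^^ n"] by (simp add: o_def)
qed

lemma scaleC_left_commute: "c *\<^sub>C d *\<^sub>C x = d *\<^sub>C c *\<^sub>C x"
  by (rule ell2_eqI) (simp add: ell2_nth_simps)

lemma scaleC_sum_right: "c *\<^sub>C (\<Sum>i\<in>A. f i) = (\<Sum>i\<in>A. c *\<^sub>C f i)"
  by (rule ell2_eqI) (simp add: ell2_nth_simps ell2_nth_sum sum_distrib_left)

lemma bounded_linear_scaleC: "bounded_linear (\<lambda>x. c *\<^sub>C x)"
  by (rule bounded_linear_intro[of _ "cmod c"])
    (auto intro!: ell2_eqI simp: ell2_nth_simps algebra_simps norm_scaleC)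

lemma bounded_clinear_scaleC: "bounded_clinear T \<Longrightarrow> bounded_clinear (\<lambda>x. c *\<^sub>C T x)"
  by (auto simp: bounded_clinear_def scaleC_left_commute
      intro: bounded_linear_compose[OF bounded_linear_scaleC])

lemma bounded_clinear_sum:
  "(\<And>i. i \<in> A \<Longrightarrow> bounded_clinear (T i)) \<Longrightarrow> bounded_clinear (\<lambda>x. \<Sum>i\<in>A. T i x)"
  by (auto simp: bounded_clinear_def scaleC_sum_right intro!: bounded_linear_sum)

lemma cinner_sum_right: "cinner x (\<Sum>i\<in>A. f i) = (\<Sum>i\<in>A. cinner x (f i))"
  by (subst (1 2) cinner_commute) (simp add: cinner_sum_left)

lemma cinner_scaleC_right: "cinner x (c *\<^sub>C y) = cnj c * cinner x y"
  by (subst (1 2) cinner_commute) (simp add: cinner_scaleC_left)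

lemma cinner_cadjoint_left:
  "bounded_clinear T \<Longrightarrow> cinner (cadjoint T x) y = cinner x (T y)"
  by (subst (1 2) cinner_commute) (simp add: cinner_cadjoint)

lemma cinner_funpow:
  assumes "bounded_clinear T"
  shows "cinner ((T ^^ n) x) y = cinner x ((cadjoint T ^^ n) y)"
proof (induction n arbitrary: y)
  case (Suc n)
  then show ?case
    by (simp add: cinner_cadjoint[OF assms]) (simp add: funpow_swap1)
qed simp

lemma cinner_funpow_cadjoint:
  assumes "bounded_clinear T"
  shows "cinner ((cadjoint T ^^ n) x) y = cinner x ((T ^^ n) y)"
  by (subst (1 2) cinner_commute) (simp add: cinner_funpow[OF assms])

lemma cinner_commutator_powers:
  assumes "bounded_clinear T"
  shows "cinner (commutator (cadjoint T ^^ j) (T ^^ i) x) y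
    = cinner ((T ^^ i) x) ((T ^^ j) y) - cinner ((cadjoint T ^^ j) x) ((cadjoint T ^^ i) y)"
  by (simp add: commutator_def cinner_diff_left cinner_funpow[OF assms]
      cinner_funpow_cadjoint[OF assms])

lemma funpow_scaleC:
  assumes "bounded_clinear T"
  shows "(T ^^ n) (c *\<^sub>C x) = c *\<^sub>C (T ^^ n) x"
  using bounded_clinear_funpow[OF assms] by (simp add: bounded_clinear_def)

lemma funpow_cadjoint_scaleC:
  assumes "bounded_clinear T"
  shows "(cadjoint T ^^ n) (c *\<^sub>C x) = c *\<^sub>C (cadjoint T ^^ n) x"
  by (rule ell2_eqI)
    (simp add: cinner_basis_right[symmetric] scaleC.rep_eq cinner_funpow_cadjoint[OF assms]
      cinner_scaleC_left del: funpow.simps)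

lemma cinner_linear_combinations:
  "cinner (\<Sum>i\<in>I. c i *\<^sub>C f i) (\<Sum>j\<in>J. d j *\<^sub>C g j)
    = (\<Sum>i\<in>I. \<Sum>j\<in>J. c i * (cnj (d j) * cinner (f i) (g j)))"
  unfolding cinner_sum_left
  by (simp only: cinner_sum_right cinner_scaleC_left cinner_scaleC_right sum_distrib_left)
    (intro sum.cong refl mult.left_commute)

text \<open>For \<open>A\<close> the combination of powers,
  \<open><[A*, A] y, y> = |A y|^2 - |A* y|^2\<close>. Expanding both squares gives the form of the
  commutator matrix at the parallel vectors \<open>X j = cnj (c j) y\<close>; the conjugates come
  from the adjoint of \<open>A\<close>.\<close>

lemma hyponormal_sum_powers:
  assumes T: "bounded_clinear T"
    and nonneg: "\<And>y. (\<Sum>i=1..k. cinner (\<Sum>j=1..k. commutator (cadjoint T ^^ j) (T ^^ i)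
      (cnj (c j) *\<^sub>C y)) (cnj (c i) *\<^sub>C y)) \<in> \<real>\<^sub>\<ge>\<^sub>0"
  shows "hyponormal (\<lambda>x. \<Sum>j=1..k. c j *\<^sub>C (T ^^ j) x)"
proof -
  let ?A = "\<lambda>x. \<Sum>j=1..k. c j *\<^sub>C (T ^^ j) x"
  let ?S = "\<lambda>x. \<Sum>j=1..k. cnj (c j) *\<^sub>C (cadjoint T ^^ j) x"
  have A: "bounded_clinear ?A"
    by (intro bounded_clinear_sum bounded_clinear_scaleC bounded_clinear_funpow T)
  have S: "cadjoint ?A = ?S"
    by (rule cadjoint_eqI)
      (simp add: cinner_sum_left cinner_sum_right cinner_scaleC_left cinner_scaleC_right
        cinner_funpow[OF T] del: funpow.simps)
  have "cinner (cadjoint ?A (?A y) - ?A (cadjoint ?A y)) y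
      = (\<Sum>i=1..k. cinner (\<Sum>j=1..k. commutator (cadjoint T ^^ j) (T ^^ i)
      (cnj (c j) *\<^sub>C y)) (cnj (c i) *\<^sub>C y))" for y
  proof -
    have "cinner (cadjoint ?A (?A y) - ?A (cadjoint ?A y)) y
        = cinner (?A y) (?A y) - cinner (?S y) (?S y)"
      using cinner_cadjoint_left[OF A, of "?A y" y] cinner_cadjoint[OF A, of "cadjoint ?A y" y]
      unfolding cinner_diff_left S by simp
    also have "\<dots> = (\<Sum>i=1..k. \<Sum>j=1..k. c i * (cnj (c j) * cinner ((T ^^ i) y) ((T ^^ j) y)))
        - (\<Sum>j=1..k. \<Sum>i=1..k. cnj (c j) * (c i * cinner ((cadjoint T ^^ j) y) ((cadjoint T ^^ i) y)))"
      by (simp only: cinner_linear_combinations complex_cnj_cnj)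
    also have "(\<Sum>j=1..k. \<Sum>i=1..k. cnj (c j) * (c i * cinner ((cadjoint T ^^ j) y) ((cadjoint T ^^ i) y)))
        = (\<Sum>i=1..k. \<Sum>j=1..k. cnj (c j) * (c i * cinner ((cadjoint T ^^ j) y) ((cadjoint T ^^ i) y)))"
      by (rule sum.swap)
    also have "(\<Sum>i=1..k. \<Sum>j=1..k. c i * (cnj (c j) * cinner ((T ^^ i) y) ((T ^^ j) y))) - \<dots>
      = (\<Sum>i=1..k. cinner (\<Sum>j=1..k. commutator (cadjoint T ^^ j) (T ^^ i)
        (cnj (c j) *\<^sub>C y)) (cnj (c i) *\<^sub>C y))"
      unfolding cinner_sum_left sum_subtractf[symmetric]
      by (intro sum.cong refl)
        (simp add: cinner_commutator_powers[OF T] funpow_scaleC[OF T] funpow_cadjoint_scaleC[OF T]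
          cinner_scaleC_left cinner_scaleC_right algebra_simps del: funpow.simps)
    finally show ?thesis .
  qed
  then show ?thesis
    unfolding hyponormal_def positive_op_def using A nonneg by simp
qed

section \<open>Powers of a weighted shift and the decomposition into diagonals\<close>

context
  fixes \<alpha> :: "nat \<Rightarrow> real"
  assumes bdd: "bounded (range \<alpha>)" and pos: "\<And>n. 0 < \<alpha> n"
begin

lemma weight_prod_pos: "0 < weight_prod \<alpha> n"
  by (simp add: weight_prod_def prod_pos pos)

lemma weight_prod_Suc: "weight_prod \<alpha> (Suc n) = weight_prod \<alpha> n * \<alpha> n"
  by (simp add: weight_prod_def)

lemma ell2_nth_shift_funpow:
  "ell2_nth ((weighted_shift \<alpha> ^^ i) x) n =
    (if i \<le> n then of_real (weight_prod \<alpha> n / weight_prod \<alpha> (n - i)) * ell2_nth x (n - i) else 0)"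
proof (induction i arbitrary: n)
  case 0
  then show ?case using weight_prod_pos[of n] by simp
next
  case (Suc i)
  then show ?case
    by (cases n) (simp_all add: ell2_nth_weighted_shift[OF bdd] weight_prod_Suc)
qed

lemma ell2_nth_cadjoint_shift:
  "ell2_nth (cadjoint (weighted_shift \<alpha>) x) n = of_real (\<alpha> n) * ell2_nth x (Suc n)"
proof -
  have "cnj (ell2_nth (cadjoint (weighted_shift \<alpha>) x) n) = cinner (weighted_shift \<alpha> (ell2_basis n)) x"
    by (simp add: cinner_cadjoint[OF bounded_clinear_weighted_shift[OF bdd]] cinner_basis_left)
  also have "\<dots> = cnj (of_real (\<alpha> n) * ell2_nth x (Suc n))"
    by (simp add: weighted_shift_basis[OF bdd] cinner_scaleC_left cinner_basis_left)
  finally show ?thesis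
    by (simp only: complex_cnj_cancel_iff)
qed

lemma ell2_nth_cadjoint_shift_funpow:
  "ell2_nth ((cadjoint (weighted_shift \<alpha>) ^^ i) x) n
    = of_real (weight_prod \<alpha> (n + i) / weight_prod \<alpha> n) * ell2_nth x (n + i)"
proof (induction i arbitrary: n)
  case 0
  then show ?case using weight_prod_pos[of n] by simp
next
  case (Suc i)
  then show ?case
    using pos[of n] weight_prod_pos[of n]
    by (simp add: ell2_nth_cadjoint_shift weight_prod_Suc)
qed

lemma commutator_shift_sums:
  assumes "i \<le> k" "j \<le> k"
  shows "(\<lambda>p. complex_of_real (shift_kernel \<alpha> k p i j)
      * diagonal_coeff \<alpha> k X p j * cnj (diagonal_coeff \<alpha> k X p i))
    sums cinner (commutator (cadjoint (weighted_shift \<alpha>) ^^ j) (weighted_shift \<alpha> ^^ i) (X j)) (X i)"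
proof -
  let ?T = "weighted_shift \<alpha>"
  note bT = bounded_clinear_weighted_shift[OF bdd]
  let ?f = "\<lambda>m. ell2_nth ((?T ^^ i) (X j)) m * cnj (ell2_nth ((?T ^^ j) (X i)) m)"
  let ?h = "\<lambda>m. ell2_nth ((cadjoint ?T ^^ j) (X j)) m
    * cnj (ell2_nth ((cadjoint ?T ^^ i) (X i)) m)"
  \<comment> \<open>In \<open>?f m\<close> the vectors \<open>X j\<close> and \<open>X i\<close> are
    read at \<open>m - i\<close> and \<open>m - j\<close>, so the diagonal is
    \<open>n = m - i - j\<close> and \<open>p = m + k - (i + j)\<close>. One of the two truncated
    differences is 0. The terms dropped when \<open>i + j > k\<close> vanish, since
    \<open>m < i + j - k\<close> and \<open>j \<le> k\<close> give \<open>m < i\<close>. In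
    \<open>?h m\<close> the diagonal is \<open>n = m\<close>.\<close>
  let ?F = "\<lambda>p. if k - (i + j) \<le> p then ?f (p - (k - (i + j)) + (i + j - k)) else 0"
  let ?H = "\<lambda>p. if k \<le> p then ?h (p - k + 0) else 0"
  have "?F sums cinner ((?T ^^ i) (X j)) ((?T ^^ j) (X i))"
    by (rule sums_reindex[OF cinner_eq_sums]) (use assms in \<open>auto simp: ell2_nth_shift_funpow\<close>)
  moreover have "?H sums cinner ((cadjoint ?T ^^ j) (X j)) ((cadjoint ?T ^^ i) (X i))"
    by (rule sums_reindex[OF cinner_eq_sums]) simp
  ultimately have *: "(\<lambda>p. ?F p - ?H p) sums
      cinner (commutator (cadjoint ?T ^^ j) (?T ^^ i) (X j)) (X i)"
    unfolding cinner_commutator_powers[OF bT] by (rule sums_diff)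
  have wn: "weight_prod \<alpha> n \<noteq> 0" for n
    using weight_prod_pos[of n] by simp
  have F: "?F p = (if k \<le> p + i \<and> k \<le> p + j then of_real (moment \<alpha> (p + i + j - k)) else 0)
      * diagonal_coeff \<alpha> k X p j * cnj (diagonal_coeff \<alpha> k X p i)" for p
  proof (cases "k \<le> p + i \<and> k \<le> p + j")
    case True
    then have "k - (i + j) \<le> p" and m: "p - (k - (i + j)) + (i + j - k) = p + i + j - k"
      by auto
    moreover have "p + i + j - k - i = p + j - k" "p + i + j - k - j = p + i - k"
      "i \<le> p + i + j - k" "j \<le> p + i + j - k"
      using True assms by auto
    ultimately show ?thesis
      using True by (simp add: m ell2_nth_shift_funpow diagonal_coeff_def moment_def power2_eq_square)
  next
    case False
    then have "\<not> (k - (i + j) \<le> p \<and> i \<le> p - (k - (i + j)) + (i + j - k)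
        \<and> j \<le> p - (k - (i + j)) + (i + j - k))"
      using assms by linarith
    with False show ?thesis
      by (auto simp: ell2_nth_shift_funpow simp del: diff_diff_left)
  qed
  have H: "?H p = (if k \<le> p
      then of_real (moment \<alpha> (p - k + i) * moment \<alpha> (p - k + j) / moment \<alpha> (p - k)) else 0)
      * diagonal_coeff \<alpha> k X p j * cnj (diagonal_coeff \<alpha> k X p i)" for p
  proof (cases "k \<le> p")
    case True
    then have "p + i - k = p - k + i" "p + j - k = p - k + j" by auto
    then show ?thesis
      using True wn by (simp add: ell2_nth_cadjoint_shift_funpow diagonal_coeff_def moment_def
          power2_eq_square field_simps)
  qed simp
  have "?F p - ?H p = complex_of_real (shift_kernel \<alpha> k p i j)
      * diagonal_coeff \<alpha> k X p j * cnj (diagonal_coeff \<alpha> k X p i)" for p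
    unfolding F H by (simp add: shift_kernel_def algebra_simps)
  then show ?thesis
    using * by simp
qed

lemma commutator_matrix_sums:
  "(\<lambda>p. complex_of_real (diagonal_form \<alpha> k X p))
    sums (\<Sum>i=1..k. cinner (\<Sum>j=1..k.
      commutator (cadjoint (weighted_shift \<alpha>) ^^ j) (weighted_shift \<alpha> ^^ i) (X j)) (X i))"
  unfolding diagonal_form_def cinner_sum_left
  by (subst hermitian_form_eq[symmetric])
    (auto intro!: sums_sum commutator_shift_sums simp: shift_kernel_commute)

end

section \<open>Hankel forms\<close>

text \<open>The denominators are moments of \<open>t^q dt\<close> on \<open>[0, 1]\<close>, so the
  form is the integral of \<open>t^q (\<Sum>i. a i * t^(e i))^2\<close>. Free exponents
  \<open>e\<close> accommodate the truncated indices of the diagonals \<open>n < 0\<close>.\<close>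

lemma hankel_form_nonneg:
  fixes a :: "nat \<Rightarrow> real" and e :: "nat \<Rightarrow> nat"
  assumes "finite I"
  shows "0 \<le> (\<Sum>i\<in>I. \<Sum>j\<in>I. a i * a j / (real (e i) + real (e j) + real q + 1))"
proof (rule has_integral_nonneg)
  have "((\<lambda>t::real. t ^ n) has_integral 1 / (real n + 1)) {0..1}" for n
  proof -
    have "((\<lambda>t. t ^ Suc n / (real n + 1)) has_real_derivative t ^ n) (at t within {0..1})" for t
    proof -
      have "((\<lambda>t. t ^ Suc n) has_real_derivative (real n + 1) * t ^ n) (at t within {0..1})"
        using DERIV_pow[of "Suc n" t "{0..1}"] by (simp add: add.commute)
      from DERIV_cdivide[OF this, of "real n + 1"] show ?thesis by simp
    qed
    then show ?thesis
      using fundamental_theorem_of_calculus[of 0 1 "\<lambda>t. t ^ Suc n / (real n + 1)" "\<lambda>t. t ^ n"]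
      by (simp add: has_real_derivative_iff_has_vector_derivative[symmetric])
  qed
  then have "((\<lambda>t. a i * a j * t ^ (e i + e j + q)) has_integral
      a i * a j * (1 / (real (e i + e j + q) + 1))) {0..1}"
    for i j by (rule has_integral_mult_right)
  then have "((\<lambda>t. \<Sum>i\<in>I. \<Sum>j\<in>I. a i * a j * t ^ (e i + e j + q)) has_integral
      (\<Sum>i\<in>I. \<Sum>j\<in>I. a i * a j * (1 / (real (e i + e j + q) + 1)))) {0..1}"
    by (intro has_integral_sum assms)
  then show "((\<lambda>t. \<Sum>i\<in>I. \<Sum>j\<in>I. a i * a j * t ^ (e i + e j + q)) has_integral
      (\<Sum>i\<in>I. \<Sum>j\<in>I. a i * a j / (real (e i) + real (e j) + real q + 1))) {0..1}"
    by (simp add: add_ac)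
  show "0 \<le> (\<Sum>i\<in>I. \<Sum>j\<in>I. a i * a j * t ^ (e i + e j + q))" if "t \<in> {0..1}" for t :: real
  proof -
    have "(\<Sum>i\<in>I. \<Sum>j\<in>I. a i * a j * t ^ (e i + e j + q)) = t ^ q * (\<Sum>i\<in>I. a i * t ^ e i)\<^sup>2"
      by (simp add: power2_eq_square sum_product sum_distrib_left power_add mult_ac)
    then show ?thesis
      using that by simp
  qed
qed

section \<open>Finite differences of polynomials and of reciprocals\<close>

lemma alternating_binomial_sum_Suc:
  fixes f :: "nat \<Rightarrow> real"
  shows "(\<Sum>a\<le>Suc k. (-1) ^ a * real (Suc k choose a) * f a)
    = (\<Sum>a\<le>k. (-1) ^ a * real (k choose a) * (f a - f (Suc a)))"
proof -
  \<comment> \<open>Pascal's rule, after splitting off the term \<open>a = 0\<close>.\<close>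
  have "(\<Sum>a\<le>Suc k. (-1) ^ a * real (Suc k choose a) * f a)
      = f 0 - (\<Sum>a\<le>k. (-1) ^ a * (real (k choose a) + real (k choose Suc a)) * f (Suc a))"
    by (subst sum.atMost_Suc_shift) (simp add: sum_negf)
  also have "\<dots> = (f 0 - (\<Sum>a\<le>k. (-1) ^ a * real (k choose Suc a) * f (Suc a)))
      - (\<Sum>a\<le>k. (-1) ^ a * real (k choose a) * f (Suc a))"
    by (simp add: algebra_simps sum.distrib)
  also have "f 0 - (\<Sum>a\<le>k. (-1) ^ a * real (k choose Suc a) * f (Suc a))
      = (\<Sum>a\<le>Suc k. (-1) ^ a * real (k choose a) * f a)"
    by (subst sum.atMost_Suc_shift) (simp add: sum_negf)
  also have "\<dots> = (\<Sum>a\<le>k. (-1) ^ a * real (k choose a) * f a)"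
    by (simp add: binomial_eq_0)
  finally show ?thesis
    by (simp add: sum_subtractf algebra_simps)
qed

text \<open>The leading terms of \<open>p(z)\<close> and \<open>p(z + 1)\<close> cancel.\<close>

lemma degree_poly_difference_less:
  fixes p :: "real poly"
  assumes "degree p < Suc k" "k > 0"
  shows "degree (p - pcompose p [:1, 1:]) < k"
proof (cases "degree p = 0")
  case True
  then obtain c where "p = [:c:]" by (rule degree_eq_zeroE)
  then show ?thesis using assms by simp
next
  case False
  have d: "degree (pcompose p [:1, 1:]) = degree p"
    by (simp add: degree_pcompose)
  have "coeff (p - pcompose p [:1, 1:]) (degree p) = 0"
    using lead_coeff_comp[of "[:1, 1:]" p] by (simp add: d)
  then have "degree (p - pcompose p [:1, 1:]) < degree p"
    using False d degree_diff_le_max[of p "pcompose p [:1, 1:]"]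
    by (metis eq_zero_or_degree_less max.idem neq0_conv degree_0)
  then show ?thesis using assms by simp
qed

text \<open>Up to sign this is a \<open>k\<close>-th finite difference, and each difference lowers
  the degree.\<close>

lemma alternating_binomial_sum_poly:
  fixes p :: "real poly"
  assumes "degree p < k"
  shows "(\<Sum>a\<le>k. (-1) ^ a * real (k choose a) * poly p (real a)) = 0"
  using assms
proof (induction k arbitrary: p)
  case (Suc k)
  show ?case
  proof (cases "k = 0")
    case True
    then have "degree p = 0" using Suc.prems by simp
    then obtain c where "p = [:c:]" by (rule degree_eq_zeroE)
    then show ?thesis using True by simp
  next
    case False
    then have "degree (p - pcompose p [:1, 1:]) < k"
      using degree_poly_difference_less[OF Suc.prems] by simp
    from Suc.IH[OF this] show ?thesis
      by (simp only: alternating_binomial_sum_Suc) (simp add: poly_pcompose add.commute)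
  qed
qed simp

text \<open>Partial fraction expansion of \<open>k! / (z (z + 1) ... (z + k))\<close>. In the
  induction the sum of order \<open>k + 1\<close> is the difference of the sums of order
  \<open>k\<close> at \<open>z\<close> and \<open>z + 1\<close>.\<close>

lemma alternating_binomial_sum_inverse:
  assumes "z > 0"
  shows "(\<Sum>a\<le>k. (-1) ^ a * real (k choose a) / (z + real a)) = fact k / pochhammer z (Suc k)"
  using assms
proof (induction k arbitrary: z)
  case (Suc k)
  have "(\<Sum>a\<le>Suc k. (-1) ^ a * real (Suc k choose a) / (z + real a))
      = (\<Sum>a\<le>k. (-1) ^ a * real (k choose a) / (z + real a))
        - (\<Sum>a\<le>k. (-1) ^ a * real (k choose a) / (z + 1 + real a))"
    using alternating_binomial_sum_Suc[of k "\<lambda>a. 1 / (z + real a)"]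
    by (simp add: sum_subtractf algebra_simps diff_divide_distrib)
  also have "\<dots> = fact k / pochhammer z (Suc k) - fact k / pochhammer (z + 1) (Suc k)"
    using Suc.IH[of z] Suc.IH[of "z + 1"] Suc.prems by simp
  also have "\<dots> = fact (Suc k) / pochhammer z (Suc (Suc k))"
  proof -
    have p: "pochhammer (z + 1) k > 0"
      using Suc.prems by (intro pochhammer_pos) simp
    have "pochhammer z (Suc k) = z * pochhammer (z + 1) k"
      "pochhammer (z + 1) (Suc k) = pochhammer (z + 1) k * (z + 1 + real k)"
      "pochhammer z (Suc (Suc k)) = z * (pochhammer (z + 1) k * (z + 1 + real k))"
      by (rule pochhammer_rec, rule pochhammer_Suc)
        (simp only: pochhammer_rec[of z "Suc k"] pochhammer_Suc[of "z + 1" k])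
    \<comment> \<open>Here \<open>q\<close> is the common Pochhammer factor and
      \<open>d = z + 1 + k\<close>, so \<open>d - z = k + 1\<close> turns \<open>k!\<close> into
      \<open>(k + 1)!\<close>.\<close>
    moreover have "f / (z * q) - f / (q * d) = (d - z) * f / (z * (q * d))"
      if "q > 0" "d > 0" for f q d :: real
      using that Suc.prems by (simp add: field_simps)
    from this[OF p, of "z + 1 + real k" "fact k"]
    have "fact k / (z * pochhammer (z + 1) k) - fact k / (pochhammer (z + 1) k * (z + 1 + real k))
        = (1 + real k) * fact k / (z * (pochhammer (z + 1) k * (z + 1 + real k)))"
      using Suc.prems by simp
    ultimately show ?thesis
      by simp
  qed
  finally show ?case .
qed simp

text \<open>First column of the inverse of the matrix \<open>1 / (a + b + 2)\<close>, \<open>0 \<le> a, b \<le> k\<close>: the residues of the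
  rational function with poles \<open>-2, \<dots>, -k - 2\<close> and zeros \<open>1, \<dots>, k\<close> that takes the value 1 at 0.\<close>

definition hankel_kernel :: "nat \<Rightarrow> nat \<Rightarrow> real"
  where "hankel_kernel k a = (real k + 1) * (real k + 2) / fact k
    * ((-1) ^ a * real (k choose a) * pochhammer (real a + 3) k)"

lemma hankel_kernel_0: "hankel_kernel k 0 = (real k + 1)\<^sup>2 * (real k + 2)\<^sup>2 / 2"
proof -
  have "2 * pochhammer (3::real) k = fact (k + 2)"
    by (induction k) (simp_all add: pochhammer_Suc algebra_simps)
  then have p: "pochhammer (3::real) k = fact k * ((real k + 1) * (real k + 2)) / 2"
    by (simp add: algebra_simps)
  then show ?thesis
    by (simp add: hankel_kernel_def p power2_eq_square)
qed

text \<open>Ensures a positive divisor \<open>hankel_kernel k 0 - 2\<close> in the Schur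
  complement.\<close>

lemma hankel_kernel_0_gt:
  assumes "k \<ge> 1"
  shows "hankel_kernel k 0 > 2"
proof -
  have "(real k + 1)\<^sup>2 * (real k + 2)\<^sup>2 \<ge> 2\<^sup>2 * 3\<^sup>2"
    using assms by (intro mult_mono power_mono) auto
  then show ?thesis by (simp add: hankel_kernel_0)
qed

text \<open>Indexed by a set so that cancelling the denominator \<open>a + b + 2\<close> amounts to
  removing \<open>b\<close>.\<close>

definition shifted_prod :: "nat set \<Rightarrow> real poly"
  where "shifted_prod B = (\<Prod>b\<in>B. [:real b + 2, 1:])"

lemma poly_shifted_prod: "poly (shifted_prod B) z = (\<Prod>b\<in>B. z + real b + 2)"
  by (simp add: shifted_prod_def poly_prod add_ac)

lemma degree_shifted_prod: "finite B \<Longrightarrow> degree (shifted_prod B) = card B"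
  unfolding shifted_prod_def by (subst degree_prod_eq_sum_degree) auto

lemma pochhammer_eq_shifted_prod: "pochhammer (real a + 3) k = poly (shifted_prod {1..k}) (real a)"
  unfolding poly_shifted_prod pochhammer_prod
  by (rule prod.reindex_bij_witness[of _ "\<lambda>b. b - 1" Suc]) auto

text \<open>If \<open>b > 0\<close>, the denominator cancels a factor of the Pochhammer symbol; a
  polynomial of degree \<open>k - 1\<close> remains, and its \<open>k\<close>-th difference
  vanishes. If \<open>b = 0\<close>, only the remainder of the division by \<open>z + 2\<close>
  contributes, through the partial fraction sum at \<open>z = 2\<close>.\<close>

lemma hankel_kernel_reproducing:
  assumes "b \<le> k"
  shows "(\<Sum>a\<le>k. hankel_kernel k a / (real a + real b + 2)) = (if b = 0 then 1 else 0)"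
proof (cases "b = 0")
  case False
  define B where "B = {1..k} - {b}"
  have B: "{1..k} = insert b B" "b \<notin> B" "finite B" "card B < k"
    using False assms by (auto simp: B_def)
  have "pochhammer (real a + 3) k / (real a + real b + 2) = poly (shifted_prod B) (real a)" for a
  proof -
    have "real a + real b + 2 > 0" by simp
    then show ?thesis
      unfolding pochhammer_eq_shifted_prod B(1) using B by (simp add: poly_shifted_prod)
  qed
  then have "(\<Sum>a\<le>k. hankel_kernel k a / (real a + real b + 2))
      = (real k + 1) * (real k + 2) / fact k
        * (\<Sum>a\<le>k. (-1) ^ a * real (k choose a) * poly (shifted_prod B) (real a))"
    unfolding hankel_kernel_def sum_distrib_left
    by (intro sum.cong refl) (metis (no_types, lifting) times_divide_eq_right)
  also have "\<dots> = 0"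
    using alternating_binomial_sum_poly[of "shifted_prod B" k] degree_shifted_prod[OF B(3)] B(4)
    by simp
  finally show ?thesis using False by simp
next
  case True
  let ?p = "shifted_prod {1..k}"
  \<comment> \<open>The quotient by \<open>z + 2\<close>; the remainder is the value at
    \<open>-2\<close>, the product of \<open>1, ..., k\<close>.\<close>
  define Q where "Q = synthetic_div ?p (-2)"
  have Q: "poly ?p z = fact k + (z + 2) * poly Q z" for z
  proof -
    have "poly ?p (-2) = fact k"
      by (simp add: poly_shifted_prod fact_prod)
    then have "?p = [:2, 1:] * Q + [:fact k:]"
      using synthetic_div_correct'[of "-2" ?p] by (simp add: Q_def)
    then show ?thesis by (simp add: algebra_simps)
  qed
  have "(\<Sum>a\<le>k. (-1) ^ a * real (k choose a) * poly Q (real a)) = 0"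
  proof (cases "k = 0")
    case True
    then have "Q = 0"
      by (simp add: Q_def shifted_prod_def synthetic_div_eq_0_iff)
    then show ?thesis by simp
  next
    case False
    then show ?thesis
      by (intro alternating_binomial_sum_poly)
        (simp add: Q_def degree_synthetic_div degree_shifted_prod)
  qed
  moreover have *: "pochhammer (real a + 3) k / (real a + 2)
      = fact k * (1 / (2 + real a)) + poly Q (real a)" for a
  proof -
    have "real a + 2 > 0" by simp
    then show ?thesis
      unfolding pochhammer_eq_shifted_prod Q by (simp add: field_simps)
  qed
  moreover have "hankel_kernel k a / (real a + 2) = (real k + 1) * (real k + 2) / fact k
      * (fact k * ((-1) ^ a * real (k choose a) / (2 + real a))
        + (-1) ^ a * real (k choose a) * poly Q (real a))" for a
    unfolding hankel_kernel_def times_divide_eq_right[symmetric] mult.assoc *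
    by (simp add: algebra_simps)
  then have "(\<Sum>a\<le>k. hankel_kernel k a / (real a + 2)) = (real k + 1) * (real k + 2) / fact k
      * (fact k * (\<Sum>a\<le>k. (-1) ^ a * real (k choose a) / (2 + real a))
        + (\<Sum>a\<le>k. (-1) ^ a * real (k choose a) * poly Q (real a)))"
    by (simp only: sum_distrib_left sum.distrib distrib_left)
  ultimately have "(\<Sum>a\<le>k. hankel_kernel k a / (real a + 2))
      = (real k + 1) * (real k + 2) / fact k
        * (fact k * (\<Sum>a\<le>k. (-1) ^ a * real (k choose a) / (2 + real a)))"
    by simp
  also have "(\<Sum>a\<le>k. (-1) ^ a * real (k choose a) / (2 + real a)) = fact k / pochhammer 2 (Suc k)"
    by (rule alternating_binomial_sum_inverse) simp
  also have "pochhammer (2::real) (Suc k) = (real k + 1) * (real k + 2) * fact k"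
    by (induction k) (simp_all add: pochhammer_Suc algebra_simps)
  also have "(real k + 1) * (real k + 2) / fact k
      * (fact k * (fact k / ((real k + 1) * (real k + 2) * fact k))) = 1"
  proof -
    have "c / f * (f * (f / (c * f))) = 1" if "c \<noteq> 0" "f \<noteq> 0" for c f :: real
      using that by simp
    from this[of "(real k + 1) * (real k + 2)" "fact k"] show ?thesis
      by simp
  qed
  finally show ?thesis
    using True by simp
qed

text \<open>With \<open>d = n + 2\<close>, the identity
  \<open>(d + i) (d + j) - d (d + i + j) = i j\<close> shows that the matrix is the Hankel matrix
  \<open>1 / (d + i + j)\<close> scaled on both sides by \<open>i / (d + i)\<close>.\<close>

lemma shifted_hankel_form_nonneg:
  fixes a :: "nat \<Rightarrow> real"
  assumes "finite I"
  shows "0 \<le> (\<Sum>i\<in>I. \<Sum>j\<in>I. (1 / (real n + 2 + real i + real j)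
      - (real n + 2) / ((real n + 2 + real i) * (real n + 2 + real j))) * a i * a j)"
proof -
  define u where "u i = real i * a i / (real n + 2 + real i)" for i
  have "0 \<le> (\<Sum>i\<in>I. \<Sum>j\<in>I. u i * u j / (real i + real j + real (n + 1) + 1))"
    by (rule hankel_form_nonneg[OF assms, where e = "\<lambda>i. i"])
  also have "\<dots> = (\<Sum>i\<in>I. \<Sum>j\<in>I. (1 / (real n + 2 + real i + real j)
      - (real n + 2) / ((real n + 2 + real i) * (real n + 2 + real j))) * a i * a j)"
  proof (intro sum.cong refl)
    fix i j
    have "real n + 2 + real i > 0" "real n + 2 + real j > 0" "real n + 2 + real i + real j > 0"
      by simp_all
    then show "u i * u j / (real i + real j + real (n + 1) + 1) = (1 / (real n + 2 + real i + real j)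
      - (real n + 2) / ((real n + 2 + real i) * (real n + 2 + real j))) * a i * a j"
      unfolding u_def by (simp add: divide_simps) (simp add: algebra_simps)
  qed
  finally show ?thesis .
qed

text \<open>Cauchy-Schwarz: the kernel represents the functional \<open>a 0\<close> for the Hankel
  form, hence the form at \<open>a - l * ?r\<close> equals the form at \<open>a\<close> minus
  \<open>(a 0)^2 / ?r 0\<close>.\<close>

lemma hankel_form_lower_bound:
  fixes a :: "nat \<Rightarrow> real"
  shows "(a 0)\<^sup>2 / hankel_kernel k 0 \<le> (\<Sum>i\<le>k. \<Sum>j\<le>k. a i * a j / (real i + real j + 2))"
proof -
  let ?r = "hankel_kernel k"
  define l where "l = a 0 / ?r 0"
  have r0: "?r 0 > 0"
    by (simp add: hankel_kernel_0)
  have rep: "(\<Sum>j\<le>k. ?r j / (real i + real j + 2)) = (if i = 0 then 1 else 0)" if "i \<le> k" for i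
    using hankel_kernel_reproducing[OF that] by (simp add: add_ac)
  have cross: "(\<Sum>i\<le>k. \<Sum>j\<le>k. b i * ?r j / (real i + real j + 2)) = b 0" for b
  proof -
    have "(\<Sum>i\<le>k. \<Sum>j\<le>k. b i * ?r j / (real i + real j + 2))
        = (\<Sum>i\<le>k. b i * (\<Sum>j\<le>k. ?r j / (real i + real j + 2)))"
      by (simp add: sum_distrib_left)
    also have "\<dots> = (\<Sum>i\<le>k. if i = 0 then b i else 0)"
      by (intro sum.cong refl) (simp add: rep)
    finally show ?thesis by simp
  qed
  have cross': "(\<Sum>i\<le>k. \<Sum>j\<le>k. ?r i * b j / (real i + real j + 2)) = b 0" for b
    using cross[of b] by (subst sum.swap) (simp add: mult.commute add_ac)
  have "0 \<le> (\<Sum>i\<le>k. \<Sum>j\<le>k. (a i - l * ?r i) * (a j - l * ?r j) / (real i + real j + real 1 + 1))"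
    by (rule hankel_form_nonneg[where e = "\<lambda>i. i"]) simp
  also have "\<dots> = (\<Sum>i\<le>k. \<Sum>j\<le>k. a i * a j / (real i + real j + 2)
      - l * (a i * ?r j / (real i + real j + 2)) - l * (?r i * a j / (real i + real j + 2))
      + l\<^sup>2 * (?r i * ?r j / (real i + real j + 2)))"
    by (intro sum.cong refl) (simp add: algebra_simps add_divide_distrib diff_divide_distrib power2_eq_square)
  also have "\<dots> = (\<Sum>i\<le>k. \<Sum>j\<le>k. a i * a j / (real i + real j + 2)) - l * a 0 - l * a 0 + l\<^sup>2 * ?r 0"
    by (simp only: sum.distrib sum_subtractf sum_distrib_left[symmetric] cross cross')
  finally show ?thesis
    using r0 by (simp add: l_def power2_eq_square)
qed

lemma critical_form_eq:
  fixes a :: "nat \<Rightarrow> real"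
  shows "(\<Sum>i\<in>I. \<Sum>j\<in>I. (1 / (real i + real j + 2) - 3 * x / ((real i + 2) * (real j + 2))) * a i * a j)
    = (\<Sum>i\<in>I. \<Sum>j\<in>I. a i * a j / (real i + real j + 2)) - 3 * x * (\<Sum>i\<in>I. a i / (real i + 2))\<^sup>2"
proof -
  have "(1 / (real i + real j + 2) - 3 * x / ((real i + 2) * (real j + 2))) * a i * a j
      = a i * a j / (real i + real j + 2) - 3 * x * (a i / (real i + 2) * (a j / (real j + 2)))" for i j
    by (simp add: algebra_simps)
  then show ?thesis
    by (simp only: sum_subtractf sum_distrib_left[symmetric] power2_eq_square sum_product)
qed

text \<open>The Schur complement at the moment of order zero: it is the Hankel form above with its
  zeroth coordinate eliminated.\<close>

lemma critical_form_nonneg: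
  fixes a :: "nat \<Rightarrow> real"
  assumes "x * (3 * (hankel_kernel k 0 - 2)) \<le> 2 * hankel_kernel k 0" "k \<ge> 1"
  shows "0 \<le> (\<Sum>i=1..k. \<Sum>j=1..k. (1 / (real i + real j + 2) - 3 * x / ((real i + 2) * (real j + 2)))
    * a i * a j)"
proof -
  let ?r = "hankel_kernel k 0"
  have r: "?r > 2"
    using assms(2) by (rule hankel_kernel_0_gt)
  define s where "s = (\<Sum>i=1..k. a i / (real i + 2))"
  \<comment> \<open>The minimizer of \<open>z^2 / 2 + 2 z s - z^2 / ?r\<close>, which makes the
    resulting bound on \<open>H\<close> sharpest.\<close>
  define z where "z = - (2 * ?r / (?r - 2)) * s"
  define H where "H = (\<Sum>i=1..k. \<Sum>j=1..k. a i * a j / (real i + real j + 2))"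
  let ?a = "a(0 := z)"
  have I: "{..k} = insert 0 {1..k}" by auto
  have "(\<Sum>i\<le>k. \<Sum>j\<le>k. ?a i * ?a j / (real i + real j + 2)) = z\<^sup>2 / 2 + 2 * z * s + H"
  proof -
    have "(\<Sum>i\<le>k. \<Sum>j\<le>k. ?a i * ?a j / (real i + real j + 2))
      = z * z / 2 + (\<Sum>j=1..k. z * a j / (real j + 2))
        + ((\<Sum>i=1..k. a i * z / (real i + 2))
          + (\<Sum>i=1..k. \<Sum>j=1..k. a i * a j / (real i + real j + 2)))"
      unfolding I by (simp add: sum.distrib)
    then show ?thesis
      by (simp add: H_def s_def sum_distrib_left power2_eq_square mult_ac)
  qed
  with hankel_form_lower_bound[of ?a k] have "z\<^sup>2 / ?r \<le> z\<^sup>2 / 2 + 2 * z * s + H"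
    by simp
  moreover have "z\<^sup>2 / 2 + 2 * z * s - z\<^sup>2 / ?r = - (2 * ?r / (?r - 2)) * s\<^sup>2"
    using r by (simp add: z_def power2_eq_square divide_simps) (simp add: algebra_simps)
  ultimately have "2 * ?r / (?r - 2) * s\<^sup>2 \<le> H" by simp
  moreover have "3 * x * s\<^sup>2 \<le> 2 * ?r / (?r - 2) * s\<^sup>2"
    using r assms(1) by (intro mult_right_mono) (simp_all add: field_simps)
  moreover have "(\<Sum>i=1..k. \<Sum>j=1..k. (1 / (real i + real j + 2) - 3 * x / ((real i + 2) * (real j + 2)))
      * a i * a j)
      = H - 3 * x * s\<^sup>2"
    by (simp only: critical_form_eq H_def s_def)
  ultimately show ?thesis by linarith
qed

text \<open>The test vector for necessity. Row 0 of the reproducing identity gives \<open>s\<close>,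
  the other rows give the inner sums. For \<open>k \<ge> 1\<close> the first factor is positive, so
  the second one, linear in \<open>x\<close>, decides the sign.\<close>

lemma critical_form_kernel:
  "(\<Sum>i=1..k. \<Sum>j=1..k. (1 / (real i + real j + 2) - 3 * x / ((real i + 2) * (real j + 2)))
      * hankel_kernel k i * hankel_kernel k j)
    = (hankel_kernel k 0 / 2 - 1) * (hankel_kernel k 0 - 3 * x * (hankel_kernel k 0 / 2 - 1))"
proof -
  let ?r = "hankel_kernel k"
  define s where "s = (\<Sum>i=1..k. ?r i / (real i + 2))"
  have I: "{..k} = insert 0 {1..k}" by auto
  have s: "s = 1 - ?r 0 / 2"
    using hankel_kernel_reproducing[of 0 k] unfolding I s_def by simp
  have row: "(\<Sum>j=1..k. ?r j / (real i + real j + 2)) = - ?r 0 / (real i + 2)" if "i \<in> {1..k}" for i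
    using hankel_kernel_reproducing[of i k] that unfolding I by (simp add: add_ac)
  have "(\<Sum>i=1..k. \<Sum>j=1..k. (1 / (real i + real j + 2) - 3 * x / ((real i + 2) * (real j + 2)))
      * ?r i * ?r j)
      = (\<Sum>i=1..k. ?r i * (\<Sum>j=1..k. ?r j / (real i + real j + 2))) - 3 * x * s\<^sup>2"
    by (simp add: critical_form_eq s_def sum_distrib_left)
  also have "(\<Sum>i=1..k. ?r i * (\<Sum>j=1..k. ?r j / (real i + real j + 2)))
      = (\<Sum>i=1..k. ?r i * (- ?r 0 / (real i + 2)))"
    by (intro sum.cong refl) (simp only: row)
  also have "\<dots> = - ?r 0 * s"
    by (simp add: s_def sum_distrib_left mult_ac sum_negf)
  also have "- ?r 0 * s - 3 * x * s\<^sup>2 = (?r 0 / 2 - 1) * (?r 0 - 3 * x * (?r 0 / 2 - 1))"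
    by (simp add: s power2_eq_square field_simps)
  finally show ?thesis .
qed

section \<open>The weights \<open>\<alpha>(x)\<close>\<close>

lemma alpha_weights_pos: "0 < x \<Longrightarrow> 0 < alpha_weights x n"
  by (simp add: alpha_weights_def)

lemma moment_alpha_weights:
  assumes "0 < x"
  shows "moment (alpha_weights x) n = (if n = 0 then 1 else 3 * x / (real n + 2))"
proof (induction n)
  case (Suc n)
  have "moment (alpha_weights x) (Suc n) = moment (alpha_weights x) n * (alpha_weights x n)\<^sup>2"
    by (simp add: moment_def weight_prod_def power_mult_distrib)
  moreover have "(alpha_weights x n)\<^sup>2 = (if n = 0 then x else (real n + 2) / (real n + 3))"
    using assms by (simp add: alpha_weights_def)
  moreover have "a / b * (b / c) = a / c" if "b > 0" for a b c :: real
    using that by simp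
  from this[of "real n + 2" "3 * x" "real n + 3"]
  have "3 * x / (real n + 2) * ((real n + 2) / (real n + 3)) = 3 * x / (real n + 3)"
    by simp
  ultimately show ?case
    using Suc by (simp add: add_ac)
qed (simp add: moment_def weight_prod_def)

text \<open>Where the coefficients are nonzero, the moment has order
  \<open>p + i + j - k \<ge> j \<ge> 1\<close>, so the exceptional moment of order 0 does not occur
  and the exponents \<open>i - (k - p)\<close> are genuine differences.\<close>

lemma shift_kernel_below:
  assumes "0 < x" "p < k" "1 \<le> i" "1 \<le> j"
  shows "shift_kernel (alpha_weights x) k p i j * a i * a j = 3 * x *
    ((if k - p \<le> i then a i else 0) * (if k - p \<le> j then a j else 0)
      / (real (i - (k - p)) + real (j - (k - p)) + real (k - p + 1) + 1))"
proof (cases "k - p \<le> i \<and> k - p \<le> j")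
  case True
  moreover from this have "p + i + j - k \<noteq> 0"
    and eq: "real (p + i + j - k) + 2 = real (i - (k - p)) + real (j - (k - p)) + real (k - p + 1) + 1"
    using assms by (auto simp: of_nat_diff)
  moreover have "k \<le> p + i" "k \<le> p + j" using True by auto
  ultimately have "shift_kernel (alpha_weights x) k p i j = 3 * x / (real (p + i + j - k) + 2)"
    using assms by (simp add: shift_kernel_def moment_alpha_weights)
  then show ?thesis
    unfolding eq using True by simp
qed (use assms in \<open>auto simp: shift_kernel_def\<close>)

text \<open>The divisor is the moment of order 0, which is 1 rather than \<open>3 * x / 2\<close>;
  hence a factor \<open>x\<close> survives in the subtracted product.\<close>

lemma shift_kernel_critical:
  assumes "0 < x" "1 \<le> i" "1 \<le> j"
  shows "shift_kernel (alpha_weights x) k k i j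
    = 3 * x * (1 / (real i + real j + 2) - 3 * x / ((real i + 2) * (real j + 2)))"
  using assms by (simp add: shift_kernel_def moment_alpha_weights algebra_simps)

lemma shift_kernel_above:
  assumes "0 < x" "0 < n"
  shows "shift_kernel (alpha_weights x) k (k + n) i j
    = 3 * x * (1 / (real n + 2 + real i + real j)
        - (real n + 2) / ((real n + 2 + real i) * (real n + 2 + real j)))"
proof -
  have "y / c - y / a * (y / b) / (y / d) = y * (1 / c - d / (a * b))"
    if "y > 0" "a > 0" "b > 0" "c > 0" "d > 0" for a b c d y :: real
    using that by (simp add: field_simps)
  from this[of "3 * x" "real n + 2 + real i" "real n + 2 + real j" "real n + 2 + real i + real j"
      "real n + 2"]
  show ?thesis
    using assms by (simp add: shift_kernel_def moment_alpha_weights add_ac)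
qed

lemma shift_kernel_form_nonneg:
  assumes "0 < x" "p \<noteq> k"
  shows "0 \<le> (\<Sum>i=1..k. \<Sum>j=1..k. shift_kernel (alpha_weights x) k p i j * a i * a j)"
proof (cases "p < k")
  case True
  let ?b = "\<lambda>i. if k - p \<le> i then a i else 0"
  have "0 \<le> 3 * x * (\<Sum>i=1..k. \<Sum>j=1..k. ?b i * ?b j
      / (real (i - (k - p)) + real (j - (k - p)) + real (k - p + 1) + 1))"
    using assms(1) by (intro mult_nonneg_nonneg hankel_form_nonneg) auto
  also have "\<dots> = (\<Sum>i=1..k. \<Sum>j=1..k. shift_kernel (alpha_weights x) k p i j * a i * a j)"
    unfolding sum_distrib_left
    by (intro sum.cong refl shift_kernel_below[symmetric]) (use assms(1) True in auto)
  finally show ?thesis .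
next
  case False
  then obtain n where p: "p = k + n" and n: "0 < n"
    using assms(2) by (metis add_0_right gr0I le_Suc_ex linorder_not_less)
  have "0 \<le> 3 * x * (\<Sum>i=1..k. \<Sum>j=1..k. (1 / (real n + 2 + real i + real j)
        - (real n + 2) / ((real n + 2 + real i) * (real n + 2 + real j))) * a i * a j)"
    using assms(1) by (intro mult_nonneg_nonneg shifted_hankel_form_nonneg) auto
  then show ?thesis
    by (simp only: p shift_kernel_above[OF assms(1) n] sum_distrib_left mult.assoc)
qed

lemma critical_kernel_form:
  assumes "0 < x"
  shows "(\<Sum>i=1..k. \<Sum>j=1..k. shift_kernel (alpha_weights x) k k i j * a i * a j)
    = 3 * x * (\<Sum>i=1..k. \<Sum>j=1..k.
        (1 / (real i + real j + 2) - 3 * x / ((real i + 2) * (real j + 2))) * a i * a j)"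
  unfolding sum_distrib_left
  by (intro sum.cong refl) (simp add: shift_kernel_critical[OF assms] mult.assoc)

lemma sums_complex_of_real:
  assumes "(\<lambda>p. complex_of_real (f p)) sums z"
  shows "f sums Re z" "Im z = 0"
proof -
  show "f sums Re z"
    using sums_Re[OF assms] by simp
  have "(\<lambda>p. 0) sums Im z"
    using sums_Im[OF assms] by simp
  then show "Im z = 0"
    using sums_unique2 sums_zero by blast
qed

lemma nonneg_Reals_of_real_sums:
  assumes "(\<lambda>p. complex_of_real (f p)) sums z" "0 \<le> Re z"
  shows "z \<in> \<real>\<^sub>\<ge>\<^sub>0"
  using sums_complex_of_real(2)[OF assms(1)] assms(2) by (simp add: complex_nonneg_Reals_iff)

text \<open>The denominator factors \<open>(k + 1)^2 (k + 2)^2 - 4\<close> as a difference of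
  squares: \<open>(k + 1) (k + 2) - 2 = k (k + 3)\<close> and
  \<open>(k + 1) (k + 2) + 2 = k^2 + 3 k + 4\<close>.\<close>

lemma threshold_iff:
  assumes "k \<ge> 1"
  shows "x \<le> (2 * (real k + 1)^2 * (real k + 2)^2) /
      (3 * real k * (real k + 3) * ((real k)^2 + 3 * real k + 4))
    \<longleftrightarrow> x * (3 * (hankel_kernel k 0 - 2)) \<le> 2 * hankel_kernel k 0"
proof -
  have k: "real k > 0" using assms by simp
  have "3 * real k * (real k + 3) * ((real k)^2 + 3 * real k + 4) > 0"
    by (intro mult_pos_pos add_pos_pos) (use k in auto)
  moreover have "3 * real k * (real k + 3) * ((real k)^2 + 3 * real k + 4) = 2 * (3 * (hankel_kernel k 0 - 2))"
    by (simp add: hankel_kernel_0 power2_eq_square algebra_simps)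
  moreover have "2 * (real k + 1)^2 * (real k + 2)^2 = 2 * (2 * hankel_kernel k 0)"
    by (simp add: hankel_kernel_0)
  ultimately show ?thesis
    by (simp only: pos_le_divide_eq) linarith
qed

lemma k_hyponormal_alpha_weights_iff:
  assumes x: "0 < x" and k: "k \<ge> 1"
  shows "k_hyponormal k (weighted_shift (alpha_weights x))
    \<longleftrightarrow> x * (3 * (hankel_kernel k 0 - 2)) \<le> 2 * hankel_kernel k 0"
proof -
  let ?\<alpha> = "alpha_weights x"
  let ?T = "weighted_shift ?\<alpha>"
  let ?B = "\<lambda>X. \<Sum>i=1..k. cinner (\<Sum>j=1..k. commutator (cadjoint ?T ^^ j) (?T ^^ i) (X j)) (X i)"
  note sums = commutator_matrix_sums[OF bounded_alpha_weights alpha_weights_pos[OF x], of k]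
  have "positive_op_matrix k (\<lambda>i j. commutator (cadjoint ?T ^^ j) (?T ^^ i))
      \<longleftrightarrow> x * (3 * (hankel_kernel k 0 - 2)) \<le> 2 * hankel_kernel k 0"
  proof
    assume *: "x * (3 * (hankel_kernel k 0 - 2)) \<le> 2 * hankel_kernel k 0"
    have nonneg: "0 \<le> (\<Sum>i=1..k. \<Sum>j=1..k. shift_kernel ?\<alpha> k p i j * a i * a j)" for p a
    proof (cases "p = k")
      case True
      show ?thesis
        unfolding True critical_kernel_form[OF x]
        by (intro mult_nonneg_nonneg critical_form_nonneg[OF * k]) (use x in auto)
    qed (rule shift_kernel_form_nonneg[OF x])
    have "?B X \<in> \<real>\<^sub>\<ge>\<^sub>0" for X
    proof (rule nonneg_Reals_of_real_sums[OF sums])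
      have "0 \<le> diagonal_form ?\<alpha> k X p" for p
        unfolding diagonal_form_def by (intro add_nonneg_nonneg nonneg)
      then show "0 \<le> Re (?B X)"
        using sums_le[OF _ sums_zero sums_complex_of_real(1)[OF sums]] by blast
    qed
    then show "positive_op_matrix k (\<lambda>i j. commutator (cadjoint ?T ^^ j) (?T ^^ i))"
      unfolding positive_op_matrix_def by blast
  next
    assume *: "positive_op_matrix k (\<lambda>i j. commutator (cadjoint ?T ^^ j) (?T ^^ i))"
    let ?r = "hankel_kernel k"
    \<comment> \<open>Placing \<open>X j\<close> at coordinate \<open>j\<close> leaves only the
      diagonal \<open>p = k\<close>, that is \<open>n = 0\<close>; the weight product cancels the
      normalization in \<open>diagonal_coeff\<close>.\<close>
    define X where "X j = complex_of_real (weight_prod ?\<alpha> j * ?r j) *\<^sub>C ell2_basis j" for j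
    have coeff: "diagonal_coeff ?\<alpha> k X p i = (if p = k then of_real (?r i) else 0)" for p i
      using weight_prod_pos[OF bounded_alpha_weights alpha_weights_pos[OF x], of i]
      by (auto simp: diagonal_coeff_def X_def scaleC.rep_eq ell2_basis.rep_eq)
    have "diagonal_form ?\<alpha> k X p = (if p = k then diagonal_form ?\<alpha> k X k else 0)" for p
      by (simp add: diagonal_form_def coeff)
    then have "diagonal_form ?\<alpha> k X = (\<lambda>p. if p = k then diagonal_form ?\<alpha> k X k else 0)"
      by blast
    then have "diagonal_form ?\<alpha> k X sums diagonal_form ?\<alpha> k X k"
      using sums_single[of k "\<lambda>_. diagonal_form ?\<alpha> k X k"] by simp
    then have "Re (?B X) = diagonal_form ?\<alpha> k X k"
      using sums_complex_of_real(1)[OF sums] sums_unique2 by blast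
    moreover have "?B X \<in> \<real>\<^sub>\<ge>\<^sub>0"
      using * by (simp only: positive_op_matrix_def)
    ultimately have "0 \<le> diagonal_form ?\<alpha> k X k"
      by (simp only: complex_nonneg_Reals_iff)
    also have "\<dots> = 3 * x * ((?r 0 / 2 - 1) * (?r 0 - 3 * x * (?r 0 / 2 - 1)))"
      by (simp add: diagonal_form_def coeff critical_kernel_form[OF x] critical_form_kernel del: One_nat_def)
    finally have "0 \<le> ?r 0 - 3 * x * (?r 0 / 2 - 1)"
      using x hankel_kernel_0_gt[OF k] by (simp add: zero_le_mult_iff)
    then show "x * (3 * (?r 0 - 2)) \<le> 2 * ?r 0"
      by (simp add: algebra_simps)
  qed
  then show ?thesis
    using bounded_clinear_weighted_shift[OF bounded_alpha_weights]
    by (simp only: k_hyponormal_def simp_thms)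
qed

section \<open>Quartic hyponormality\<close>

lemma sum_1_4: "(\<Sum>i=1..4. f i) = f 1 + f 2 + f 3 + f (4::nat)" for f :: "nat \<Rightarrow> real"
proof -
  have "{1..4::nat} = {1, 2, 3, 4}" by auto
  then show ?thesis by (simp add: add.assoc)
qed

text \<open>The constants \<open>35280\<close> and \<open>250880\<close> are optimal, being diagonal entries of the inverses of the
  respective matrices. The sums of squares come from \<open>LDL\<^sup>T\<close> factorizations with the distinguished
  variable last.\<close>

lemma hankel_form_4_bound:
  fixes a :: "nat \<Rightarrow> real"
  shows "(a 2)\<^sup>2 / 35280 \<le> (\<Sum>i=1..4. \<Sum>j=1..4. a i * a j / (real (i - 1) + real (j - 1) + 3))"
proof -
  have "(\<Sum>i=1..4. \<Sum>j=1..4. a i * a j / (real (i - 1) + real (j - 1) + 3)) - (a 2)\<^sup>2 / 35280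
      = 1/3 * (a 1 + 3/5 * a 3 + 1/2 * a 4 + 3/4 * a 2)\<^sup>2
        + 4/175 * (a 3 + 35/32 * a 4 + 35/48 * a 2)\<^sup>2 + 1/2304 * (a 4 - 6/7 * a 2)\<^sup>2"
    unfolding sum_1_4 by (simp add: field_simps power2_eq_square)
  then show ?thesis by (smt (verit) zero_le_power2 mult_nonneg_nonneg divide_nonneg_nonneg)
qed

lemma shifted_hankel_form_4_bound:
  fixes a :: "nat \<Rightarrow> real"
  shows "(a 1)\<^sup>2 / 250880 \<le> (\<Sum>i=1..4. \<Sum>j=1..4. (1 / (3 + real i + real j)
      - 3 / ((3 + real i) * (3 + real j))) * a i * a j)"
proof -
  have "(\<Sum>i=1..4. \<Sum>j=1..4. (1 / (3 + real i + real j)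
      - 3 / ((3 + real i) * (3 + real j))) * a i * a j) - (a 1)\<^sup>2 / 250880
      = 4/175 * (a 2 + 35/32 * a 3 + 10/9 * a 4 + 35/48 * a 1)\<^sup>2
        + 1/2304 * (a 3 + 64/35 * a 4 - 6/7 * a 1)\<^sup>2 + 16/1091475 * (a 4 + 165/128 * a 1)\<^sup>2"
    unfolding sum_1_4 by (simp add: field_simps power2_eq_square)
  then show ?thesis by (smt (verit) zero_le_power2 mult_nonneg_nonneg divide_nonneg_nonneg)
qed

text \<open>Since \<open>667 / 990\<close> exceeds the bound \<open>75 / 112\<close> for
  \<open>k = 4\<close>, the form alone is not positive up to the endpoint, and the product
  \<open>a 1 * a 2\<close> compensates. Its coefficient is the largest that AM-GM absorbs:
  \<open>1 / 47040 = 2 / sqrt (35280 * 250880)\<close>. The squares are an \<open>LDL^T\<close>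
  factorization at the endpoint; smaller \<open>x\<close> only increases the form.\<close>

lemma critical_form_4_bound:
  fixes a :: "nat \<Rightarrow> real"
  assumes "x \<le> 667 / 990"
  shows "a 1 * a 2 / 47040 \<le> (\<Sum>i=1..4. \<Sum>j=1..4.
    (1 / (real i + real j + 2) - 3 * x / ((real i + 2) * (real j + 2))) * a i * a j)"
proof -
  have "(\<Sum>i=1..4. \<Sum>j=1..4. a i * a j / (real i + real j + 2))
      - 667 / 330 * (\<Sum>i=1..4. a i / (real i + 2))\<^sup>2 - a 1 * a 2 / 47040
      = 151/5940 * (a 1 + 293901/236768 * a 2 + 948/755 * a 3 + 1271/1057 * a 4)\<^sup>2
        + 5219225/4455026688 * (a 2 + 1938048/1043845 * a 3 + 12648608/5219225 * a 4)\<^sup>2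
        + 1437/41753800 * (a 3 + 31750/12933 * a 4)\<^sup>2 + 253/23279400 * (a 4)\<^sup>2"
    unfolding sum_1_4 by (simp add: field_simps power2_eq_square)
  moreover have "3 * x * (\<Sum>i=1..4. a i / (real i + 2))\<^sup>2 \<le> 667 / 330 * (\<Sum>i=1..4. a i / (real i + 2))\<^sup>2"
    using assms by (intro mult_right_mono) auto
  ultimately show ?thesis
    unfolding critical_form_eq
    by (smt (verit) zero_le_power2 mult_nonneg_nonneg divide_nonneg_nonneg)
qed

lemma Re_mult_cnj: "Re (z * cnj u) = Re z * Re u + Im z * Im u"
  by simp

text \<open>AM-GM, where \<open>94080\<close> is the geometric mean of \<open>250880\<close> and
  \<open>35280\<close>, and \<open>3 / 8\<close> is the square root of
  \<open>35280 / 250880\<close>.\<close>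

lemma mult_le_half_sum:
  fixes r s :: real
  shows "2 * \<bar>r * s\<bar> / 94080 \<le> r\<^sup>2 / 250880 + s\<^sup>2 / 35280"
proof -
  have "(\<bar>r\<bar> * (3 / 8) - \<bar>s\<bar>)\<^sup>2 \<ge> 0" by simp
  then have "0 \<le> r\<^sup>2 * (9/64) - (3/4) * (\<bar>r\<bar> * \<bar>s\<bar>) + s\<^sup>2"
    by (simp add: power2_diff power_mult_distrib power_divide mult_ac)
  then show ?thesis by (simp add: abs_mult)
qed

lemma quartically_hyponormal_alpha_weights:
  assumes x: "0 < x" "x \<le> 667 / 990"
  shows "quartically_hyponormal (weighted_shift (alpha_weights x))"
proof -
  let ?\<alpha> = "alpha_weights x"
  let ?T = "weighted_shift ?\<alpha>"
  let ?w = "weight_prod ?\<alpha>"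
  have T: "bounded_clinear ?T"
    by (intro bounded_clinear_weighted_shift bounded_alpha_weights)
  note sums = commutator_matrix_sums[OF bounded_alpha_weights alpha_weights_pos[OF x(1)], of 4]
  have p3: "3 * x * ((a 2)\<^sup>2 / 35280)
      \<le> (\<Sum>i=1..4. \<Sum>j=1..4. shift_kernel ?\<alpha> 4 3 i j * a i * a j)" for a
  proof -
    have "(\<Sum>i=1..4. \<Sum>j=1..4. shift_kernel ?\<alpha> 4 3 i j * a i * a j)
      = 3 * x * (\<Sum>i=1..4. \<Sum>j=1..4. a i * a j / (real (i - 1) + real (j - 1) + 3))"
      unfolding sum_distrib_left
      by (intro sum.cong refl) (subst shift_kernel_below, use x in auto)
    then show ?thesis
      using hankel_form_4_bound[of a] x by simp
  qed
  have p4: "3 * x * (a 1 * a 2 / 47040)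
      \<le> (\<Sum>i=1..4. \<Sum>j=1..4. shift_kernel ?\<alpha> 4 4 i j * a i * a j)" for a
    unfolding critical_kernel_form[OF x(1)]
    using critical_form_4_bound[OF x(2), of a] x by (intro mult_left_mono) auto
  have p5: "3 * x * ((a 1)\<^sup>2 / 250880)
      \<le> (\<Sum>i=1..4. \<Sum>j=1..4. shift_kernel ?\<alpha> 4 5 i j * a i * a j)" for a
  proof -
    have "(\<Sum>i=1..4. \<Sum>j=1..4. shift_kernel ?\<alpha> 4 5 i j * a i * a j)
      = 3 * x * (\<Sum>i=1..4. \<Sum>j=1..4. (1 / (3 + real i + real j)
      - 3 / ((3 + real i) * (3 + real j))) * a i * a j)"
      using shift_kernel_above[OF x(1), of 1 4]
      unfolding sum_distrib_left by (intro sum.cong refl) simp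
    then show ?thesis
      using shifted_hankel_form_4_bound[of a] x by simp
  qed
  have "(\<Sum>i=1..4. cinner (\<Sum>j=1..4. commutator (cadjoint ?T ^^ j) (?T ^^ i)
      (cnj (c j) *\<^sub>C y)) (cnj (c i) *\<^sub>C y)) \<in> \<real>\<^sub>\<ge>\<^sub>0" (is "?B \<in> _") for c y
  proof -
    let ?X = "\<lambda>j. cnj (c j) *\<^sub>C y"
    let ?v = "diagonal_coeff ?\<alpha> 4 ?X"
    let ?f = "diagonal_form ?\<alpha> 4 ?X"
    note sums_f = sums_complex_of_real(1)[OF sums[of ?X]]
    \<comment> \<open>The indices 3, 4, 5 are the diagonals \<open>n = -1, 0, 1\<close>. Up to
      conjugation of \<open>c\<close>, \<open>?v 3 2 = c 2 * y_1 / w_1\<close>,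
      \<open>?v 5 1 = c 1 * y_2 / w_2\<close>, \<open>?v 4 1 = c 1 * y_1 / w_1\<close> and
      \<open>?v 4 2 = c 2 * y_2 / w_2\<close>.\<close>
    have f3: "3 * x * ((cmod (?v 3 2))\<^sup>2 / 35280) \<le> ?f 3"
      using p3[of "\<lambda>i. Re (?v 3 i)"] p3[of "\<lambda>i. Im (?v 3 i)"]
      unfolding diagonal_form_def cmod_power2 add_divide_distrib distrib_left by linarith
    have f5: "3 * x * ((cmod (?v 5 1))\<^sup>2 / 250880) \<le> ?f 5"
      using p5[of "\<lambda>i. Re (?v 5 i)"] p5[of "\<lambda>i. Im (?v 5 i)"]
      unfolding diagonal_form_def cmod_power2 add_divide_distrib distrib_left by linarith
    have f4: "3 * x * (Re (?v 4 1 * cnj (?v 4 2)) / 47040) \<le> ?f 4"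
      using p4[of "\<lambda>i. Re (?v 4 i)"] p4[of "\<lambda>i. Im (?v 4 i)"]
      unfolding diagonal_form_def Re_mult_cnj add_divide_distrib distrib_left by linarith
    \<comment> \<open>The only place where the vectors \<open>X j = cnj (c j) *\<^sub>C y\<close> being parallel is used.\<close>
    have "cmod (?v 5 1) * cmod (?v 3 2) = cmod (?v 4 1) * cmod (?v 4 2)"
      by (simp add: diagonal_coeff_def scaleC.rep_eq norm_mult norm_divide mult_ac)
    then have "\<bar>cmod (?v 5 1) * cmod (?v 3 2)\<bar> = cmod (?v 4 1 * cnj (?v 4 2))"
      by (simp add: norm_mult)
    moreover have "- cmod (?v 4 1 * cnj (?v 4 2)) \<le> Re (?v 4 1 * cnj (?v 4 2))"
      using abs_Re_le_cmod[of "?v 4 1 * cnj (?v 4 2)"] by linarith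
    ultimately have "0 \<le> (cmod (?v 3 2))\<^sup>2 / 35280 + Re (?v 4 1 * cnj (?v 4 2)) / 47040
        + (cmod (?v 5 1))\<^sup>2 / 250880"
      using mult_le_half_sum[of "cmod (?v 5 1)" "cmod (?v 3 2)"] by linarith
    then have "0 \<le> 3 * x * ((cmod (?v 3 2))\<^sup>2 / 35280 + Re (?v 4 1 * cnj (?v 4 2)) / 47040
        + (cmod (?v 5 1))\<^sup>2 / 250880)"
      using x by (intro mult_nonneg_nonneg) auto
    then have "0 \<le> ?f 3 + ?f 4 + ?f 5"
      using f3 f4 f5 unfolding distrib_left by linarith
    also have "\<dots> = sum ?f {3, 4, 5}"
      by simp
    also have "\<dots> \<le> suminf ?f"
    proof (rule sum_le_suminf)
      show "summable ?f"
        using sums_f by (rule sums_summable)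
      show "0 \<le> ?f p" if "p \<in> - {3, 4, 5}" for p
        unfolding diagonal_form_def using that x
        by (intro add_nonneg_nonneg shift_kernel_form_nonneg) auto
    qed simp
    finally have "0 \<le> Re ?B"
      using sums_unique[OF sums_f] by simp
    then show ?thesis
      by (rule nonneg_Reals_of_real_sums[OF sums])
  qed
  then show ?thesis
    unfolding weakly_k_hyponormal_def
    by (intro conjI allI T hyponormal_sum_powers[OF T])
qed

theorem theorem4:
  fixes x :: real
  assumes "x > 0"
  shows "(\<forall>k::nat. k \<ge> 1 \<longrightarrow>
      (k_hyponormal k (weighted_shift (alpha_weights x)) \<longleftrightarrow>
        0 < x \<and>
        x \<le> (2 * (real k + 1)^2 * (real k + 2)^2) /
             (3 * real k * (real k + 3) * ((real k)^2 + 3 * real k + 4))))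
    \<and> (0 < x \<and> x \<le> 667 / 990 \<longrightarrow>
        quartically_hyponormal (weighted_shift (alpha_weights x)))"
  using assms
  by (auto simp only: k_hyponormal_alpha_weights_iff threshold_iff
      intro: quartically_hyponormal_alpha_weights)

end
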